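(* Let $\Lambda<\mathrm{SL}(d,\mathbb Z)$ be a subgroup whose action on $\mathbb R^d$ is $\mathbb Z$-strongly irreducible. Let $(\Gamma_n)_n$ be any sequence of finite index subgroups of $\Gamma=\Lambda\ltimes\mathbb Z^d$ such that $[\mathbb Z^d:\Gamma_n\cap\mathbb Z^d]\to\infty$ as $n\to\infty$. Then $(\Gamma_n)_n$ defines a sofic approximation of $\Gamma$ (via the actions $\Gamma\curvearrowright\Gamma/\Gamma_n$) and $$\lim_{n\to\infty}\frac{\mathrm{rank}(\Gamma_n)-1}{[\Gamma:\Gamma_n]}=0.$$
   Context: The action of $\Lambda$ is $\mathbb Z$-strongly irreducible if there is no finite (non-empty) union of non-zero infinite index subgroups of $\mathbb Z^d$ which is $\Lambda$-invariant. The semidirect product is with respect to the standard linear action on $\mathbb Z^d$. $\mathrm{rank}$ is the minimal number of generators. The actions $\Gamma\curvearrowright\Gamma/\Gamma_n$ on finite coset spaces (with uniform probability measures) define a sofic approximation of $\Gamma$ if for every non-principal ultrafilter $\mathfrak u$ on $\mathbb N$ the ultraproduct action $\gamma[x_n]_{\mathfrak u}=[\gamma x_n]_{\mathfrak u}$ of $\Gamma$ on the Loeb probability space $\prod_n(\Gamma/\Gamma_n)/\mathfrak u$ is essentially free; equivalently, for every $\gamma\in\Gamma\setminus\{1\}$, $|\{x\in\Gamma/\Gamma_n:\gamma x=x\}|/[\Gamma:\Gamma_n]\to0$.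
   Formalization: The limit of (rank(Γ_n)−1)/[Γ:Γ_n] is claimed only for finitely generated Λ; otherwise every finite index Γ_n has infinite rank and the limit claim fails. The sofic approximation claim is for all Λ. *)

theory Defs
  imports "HOL-Analysis.Analysis" "HOL-Algebra.Left_Coset" "HOL-Algebra.Generated_Groups"
begin

section \<open>Index and rank\<close>

definition finite_index :: "('a, 'b) monoid_scheme \<Rightarrow> 'a set \<Rightarrow> bool" where
  "finite_index G H \<longleftrightarrow> finite (lcosets\<^bsub>G\<^esub> H)"

text \<open>Only meaningful for subgroups of finite index; it is \<open>0\<close> otherwise.\<close>
definition subgroup_index :: "('a, 'b) monoid_scheme \<Rightarrow> 'a set \<Rightarrow> nat" where
  "subgroup_index G H = card (lcosets\<^bsub>G\<^esub> H)"

text \<open>The value is \<open>\<infinity>\<close>, the infimum of the empty set, if the subgroup \<open>H\<close> of \<open>G\<close> is not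
  finitely generated.\<close>
definition group_rank :: "('a, 'b) monoid_scheme \<Rightarrow> 'a set \<Rightarrow> enat" where
  "group_rank G H = Inf {enat (card S) | S. finite S \<and> S \<subseteq> H \<and> generate G S = H}"


section \<open>Ultraproducts of finite sets and the Loeb measure\<close>

definition nonprincipal_ultrafilter :: "nat filter \<Rightarrow> bool" where
  "nonprincipal_ultrafilter \<uu> \<longleftrightarrow>
     \<uu> \<noteq> bot \<and>
     (\<forall>P. eventually P \<uu> \<or> eventually (\<lambda>n. \<not> P n) \<uu>) \<and>
     (\<forall>m. \<uu> \<noteq> principal {m})"

definition ultra_rel :: "nat filter \<Rightarrow> (nat \<Rightarrow> 'a set) \<Rightarrow> ((nat \<Rightarrow> 'a) \<times> (nat \<Rightarrow> 'a)) set" where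
  "ultra_rel \<uu> X =
     {(x, y). x \<in> Pi UNIV X \<and> y \<in> Pi UNIV X \<and> eventually (\<lambda>n. x n = y n) \<uu>}"

definition ultraproduct :: "nat filter \<Rightarrow> (nat \<Rightarrow> 'a set) \<Rightarrow> (nat \<Rightarrow> 'a) set set" where
  "ultraproduct \<uu> X = Pi UNIV X // ultra_rel \<uu> X"

text \<open>The internal set \<open>[A\<^sub>n]\<close>. Membership in \<open>A\<^sub>n\<close> is required only for almost all \<open>n\<close>, as some of
  the \<open>A\<^sub>n\<close> may be empty.\<close>
definition internal_set ::
  "nat filter \<Rightarrow> (nat \<Rightarrow> 'a set) \<Rightarrow> (nat \<Rightarrow> 'a set) \<Rightarrow> (nat \<Rightarrow> 'a) set set" where
  "internal_set \<uu> X A =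
     {ultra_rel \<uu> X `` {x} | x. x \<in> Pi UNIV X \<and> eventually (\<lambda>n. x n \<in> A n) \<uu>}"

definition internal_sets :: "nat filter \<Rightarrow> (nat \<Rightarrow> 'a set) \<Rightarrow> (nat \<Rightarrow> 'a) set set set" where
  "internal_sets \<uu> X = {internal_set \<uu> X A | A. \<forall>n. A n \<subseteq> X n}"

text \<open>\<open>[A\<^sub>n] \<mapsto> lim\<^sub>\<uu> |A\<^sub>n| / |X\<^sub>n|\<close>, for a sequence \<open>X\<close> of finite nonempty sets with the uniform
  probability measures. The limit along an ultrafilter exists and depends only on the set
  \<open>[A\<^sub>n]\<close>, not on the sequence \<open>A\<close>.\<close>
definition loeb_premeasure :: "nat filter \<Rightarrow> (nat \<Rightarrow> 'a set) \<Rightarrow> (nat \<Rightarrow> 'a) set set \<Rightarrow> ennreal" where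
  "loeb_premeasure \<uu> X S =
     (THE r. \<exists>A. (\<forall>n. A n \<subseteq> X n) \<and> S = internal_set \<uu> X A \<and>
        ((\<lambda>n. ennreal (real (card (A n)) / real (card (X n)))) \<longlongrightarrow> r) \<uu>)"

text \<open>The Loeb space: the Caratheodory extension of the premeasure on internal sets, with all
  Caratheodory measurable sets as measurable sets. In particular it is complete.\<close>
definition loeb_measure :: "nat filter \<Rightarrow> (nat \<Rightarrow> 'a set) \<Rightarrow> (nat \<Rightarrow> 'a) set measure" where
  "loeb_measure \<uu> X =
     (let \<Omega> = ultraproduct \<uu> X;
          \<mu> = outer_measure (internal_sets \<uu> X) (loeb_premeasure \<uu> X)
      in measure_of \<Omega> (lambda_system \<Omega> (Pow \<Omega>) \<mu>) \<mu>)"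


section \<open>Sofic approximations by finite coset spaces\<close>

text \<open>\<open>g [x\<^sub>n] = [g x\<^sub>n]\<close> on the ultraproduct of the coset spaces \<open>G / H\<^sub>n\<close>; the union runs over all
  representatives of the class \<open>\<xi>\<close>, which all contribute the same class.\<close>
definition ultra_coset_action ::
  "('a, 'b) monoid_scheme \<Rightarrow> nat filter \<Rightarrow> (nat \<Rightarrow> 'a set) \<Rightarrow> 'a
     \<Rightarrow> (nat \<Rightarrow> 'a set) set \<Rightarrow> (nat \<Rightarrow> 'a set) set" where
  "ultra_coset_action G \<uu> H g \<xi> =
     (\<Union>x\<in>\<xi>. ultra_rel \<uu> (\<lambda>n. lcosets\<^bsub>G\<^esub> (H n)) `` {\<lambda>n. g <#\<^bsub>G\<^esub> x n})"

definition sofic_approximation :: "('a, 'b) monoid_scheme \<Rightarrow> (nat \<Rightarrow> 'a set) \<Rightarrow> bool" where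
  "sofic_approximation G H \<longleftrightarrow>
     (\<forall>\<uu>. nonprincipal_ultrafilter \<uu> \<longrightarrow>
        (AE \<xi> in loeb_measure \<uu> (\<lambda>n. lcosets\<^bsub>G\<^esub> (H n)).
           \<forall>g \<in> carrier G - {\<one>\<^bsub>G\<^esub>}. ultra_coset_action G \<uu> H g \<xi> \<noteq> \<xi>))"


section \<open>Integral linear groups and their semidirect products\<close>

definition SLZ :: "(int ^ 'n ^ 'n) monoid" where
  "SLZ = \<lparr>carrier = {A. det A = 1}, mult = (**), one = mat 1\<rparr>"

definition Zvec :: "(int ^ 'n) monoid" where
  "Zvec = \<lparr>carrier = UNIV, mult = (+), one = 0\<rparr>"

text \<open>The element \<open>(A, v)\<close> is the affine map \<open>x \<mapsto> A x + v\<close>.\<close>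
definition semidirect_Zvec ::
  "(int ^ 'n ^ 'n) set \<Rightarrow> ((int ^ 'n ^ 'n) \<times> (int ^ 'n)) monoid" where
  "semidirect_Zvec \<Lambda> =
     \<lparr>carrier = \<Lambda> \<times> UNIV,
      mult = (\<lambda>(A, v) (B, w). (A ** B, v + A *v w)),
      one = (mat 1, 0)\<rparr>"

text \<open>\<open>H \<inter> \<int>\<^sup>d\<close>, where \<open>\<int>\<^sup>d\<close> is identified with its copy \<open>{1} \<times> \<int>\<^sup>d\<close> in the semidirect product.\<close>
definition translation_part :: "((int ^ 'n ^ 'n) \<times> (int ^ 'n)) set \<Rightarrow> (int ^ 'n) set" where
  "translation_part H = {v. (mat 1, v) \<in> H}"

definition Z_strongly_irreducible :: "(int ^ 'n ^ 'n) set \<Rightarrow> bool" where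
  "Z_strongly_irreducible \<Lambda> \<longleftrightarrow>
     \<not> (\<exists>\<F>. finite \<F> \<and> \<F> \<noteq> {} \<and>
          (\<forall>K\<in>\<F>. subgroup K Zvec \<and> K \<noteq> {0} \<and> \<not> finite_index Zvec K) \<and>
          (\<forall>A\<in>\<Lambda>. (*v) A ` (\<Union>\<F>) \<subseteq> \<Union>\<F>))"

end

theory Submission
  imports Defs "HOL-Library.Set_Algebras"
begin

text \<open>Let \<open>P\<^sub>n(F)\<close> be the proportion of cosets in \<open>\<Gamma>/\<Gamma>\<^sub>n\<close> fixed by all translations in \<open>F\<close>. It is invariant
  under \<open>\<Lambda>\<close>, and for \<open>F\<close> of finite index it vanishes as soon as \<open>[\<int>\<^sup>d : \<Gamma>\<^sub>n \<inter> \<int>\<^sup>d] > [\<int>\<^sup>d : F]\<close>. If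
  \<open>P\<^sub>n({v})\<close> did not tend to \<open>0\<close> for some \<open>v \<noteq> 0\<close>, choose a subgroup \<open>F\<close> containing \<open>v\<close> that is maximal among
  those for which \<open>P\<^sub>n(F)\<close> does not tend to \<open>0\<close>. Then \<open>P\<^sub>n(A F + B F)\<close> tends to \<open>0\<close> whenever
  \<open>A F \<noteq> B F\<close>, so the events belonging to distinct translates of \<open>F\<close> are almost disjoint and of equal
  size; hence there are only finitely many translates, contradicting strong irreducibility. An
  element with nontrivial linear part has infinitely many conjugates whose quotients are nonzero
  translations, so its fixed point proportion tends to \<open>0\<close> by the same counting argument.

  For the rank, \<open>\<Gamma>\<^sub>n\<close> is generated by lifts of Schreier generators of its image \<open>\<Lambda>\<^sub>n\<close> in \<open>\<Lambda>\<close> together with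
  at most \<open>d\<close> translations, whereas \<open>[\<Gamma> : \<Gamma>\<^sub>n] \<ge> [\<Lambda> : \<Lambda>\<^sub>n] [\<int>\<^sup>d : \<Gamma>\<^sub>n \<inter> \<int>\<^sup>d]\<close>.\<close>

section \<open>The groups involved\<close>

lemma SLZ_simps [simp]:
  "carrier SLZ = {A. det A = 1}" "A \<otimes>\<^bsub>SLZ\<^esub> B = A ** B" "\<one>\<^bsub>SLZ\<^esub> = mat 1"
  by (simp_all add: SLZ_def)

lemma Zvec_simps [simp]:
  "carrier Zvec = UNIV" "v \<otimes>\<^bsub>Zvec\<^esub> w = v + w" "\<one>\<^bsub>Zvec\<^esub> = 0"
  by (simp_all add: Zvec_def)

lemma semidirect_Zvec_simps [simp]:
  "carrier (semidirect_Zvec \<Lambda>) = \<Lambda> \<times> UNIV"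
  "(A, v) \<otimes>\<^bsub>semidirect_Zvec \<Lambda>\<^esub> (B, w) = (A ** B, v + A *v w)"
  "\<one>\<^bsub>semidirect_Zvec \<Lambda>\<^esub> = (mat 1, 0)"
  by (simp_all add: semidirect_Zvec_def)

section \<open>Integral inverses of integral matrices\<close>

definition real_matrix :: "int ^ 'n ^ 'm \<Rightarrow> real ^ 'n ^ 'm" where
  "real_matrix A = (\<chi> i j. of_int (A $ i $ j))"

lemma real_matrix_mult: "real_matrix (A ** B) = real_matrix A ** real_matrix B"
  by (simp add: real_matrix_def matrix_matrix_mult_def vec_eq_iff)

lemma real_matrix_one: "real_matrix (mat 1) = mat 1"
  by (simp add: real_matrix_def mat_def vec_eq_iff)

lemma real_matrix_inject: "real_matrix A = real_matrix B \<longleftrightarrow> A = B"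
  by (simp add: real_matrix_def vec_eq_iff)

lemma det_real_matrix: "det (real_matrix A) = of_int (det A)"
  by (simp add: real_matrix_def det_def)

text \<open>Cramer's rule over the reals produces an inverse whose entries are integral determinants.\<close>
lemma SLZ_inverse_exists:
  fixes A :: "int ^ 'n ^ 'n"
  assumes "det A = 1"
  obtains B where "det B = 1" "A ** B = mat 1" "B ** A = mat 1"
proof -
  \<comment> \<open>Over the field of reals Cramer's rule applies and a right inverse is also a left
    inverse; injectivity of \<open>real_matrix\<close> carries both identities back to the
    integers.\<close>
  let ?A = "real_matrix A"
  define B :: "int ^ 'n ^ 'n" where
    "B = (\<chi> k l. det (\<chi> i j. if j = k then (if i = l then 1 else 0) else A $ i $ j))"
  have det: "det ?A = 1"
    using assms by (simp add: det_real_matrix)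
  have "?A *v column l (real_matrix B) = axis l 1" for l
  proof -
    have "of_int (B $ k $ l) =
        (det (\<chi> i j. if j = k then axis l 1 $ i else ?A $ i $ j) :: real)" for k
    proof -
      have "(\<chi> i j. if j = k then axis l 1 $ i else ?A $ i $ j) =
          real_matrix (\<chi> i j. if j = k then (if i = l then 1 else 0) else A $ i $ j)"
        by (simp add: real_matrix_def vec_eq_iff axis_def)
      then show ?thesis
        by (simp add: det_real_matrix B_def)
    qed
    then have "column l (real_matrix B) =
        (\<chi> k. det (\<chi> i j. if j = k then axis l 1 $ i else ?A $ i $ j) / det ?A)"
      using det by (simp add: vec_eq_iff column_def) (simp add: real_matrix_def)
    then show ?thesis
      by (subst cramer) (simp_all add: det)
  qed
  then have "?A ** real_matrix B = mat 1"
    by (simp add: vec_eq_iff matrix_matrix_mult_def matrix_vector_mult_def column_def axis_def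
        mat_def)
  then have "?A ** real_matrix B = mat 1" "real_matrix B ** ?A = mat 1"
    using matrix_left_right_inverse by blast+
  then have inv: "A ** B = mat 1" "B ** A = mat 1"
    by (metis real_matrix_mult real_matrix_one real_matrix_inject)+
  then have "det B = 1"
    using assms det_mul[of A B] by simp
  with inv that show thesis by blast
qed

section \<open>Group structures on SL(d,Z), Z^d and the semidirect product\<close>

lemma group_SLZ: "group (SLZ :: (int ^ 'n ^ 'n) monoid)"
proof (rule groupI)
  fix A :: "int ^ 'n ^ 'n"
  assume "A \<in> carrier SLZ"
  then show "\<exists>B\<in>carrier SLZ. B \<otimes>\<^bsub>SLZ\<^esub> A = \<one>\<^bsub>SLZ\<^esub>"
    using SLZ_inverse_exists[of A] by auto
qed (auto simp: det_mul matrix_mul_assoc)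

lemma group_Zvec: "group (Zvec :: (int ^ 'n) monoid)"
proof (rule groupI)
  fix v :: "int ^ 'n"
  show "\<exists>w\<in>carrier Zvec. w \<otimes>\<^bsub>Zvec\<^esub> v = \<one>\<^bsub>Zvec\<^esub>"
    by (intro bexI[of _ "- v"]) simp_all
qed (simp_all add: add.assoc)

lemma inv_Zvec [simp]: "inv\<^bsub>Zvec\<^esub> v = - v"
  by (rule group.inv_equality[OF group_Zvec]) simp_all

lemma subgroup_Zvec_iff:
  "subgroup K Zvec \<longleftrightarrow> 0 \<in> K \<and> (\<forall>v\<in>K. \<forall>w\<in>K. v + w \<in> K) \<and> (\<forall>v\<in>K. - v \<in> K)"
  by (auto simp: subgroup_def)

lemma subgroup_Zvec_diff: "subgroup K Zvec \<Longrightarrow> v \<in> K \<Longrightarrow> w \<in> K \<Longrightarrow> v - w \<in> K"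
  unfolding subgroup_Zvec_iff by (metis diff_conv_add_uminus)

lemma subgroup_Zvec_scale:
  assumes "subgroup K Zvec" "v \<in> K"
  shows "m *s v \<in> K"
proof -
  have nat: "int n *s v \<in> K" for n
  proof (induction n)
    case (Suc n)
    have "int (Suc n) *s v = v + int n *s v"
      by (simp add: vec_eq_iff algebra_simps)
    with Suc assms show ?case
      by (simp add: subgroup_Zvec_iff)
  qed (use assms in \<open>simp add: subgroup_Zvec_iff\<close>)
  show ?thesis
  proof (cases m rule: int_cases2)
    case (nonpos n)
    moreover have "(- int n) *s v = - (int n *s v)"
      by (simp add: vec_eq_iff)
    ultimately show ?thesis
      using nat[of n] assms by (simp add: subgroup_Zvec_iff)
  qed (use nat in simp)
qed

text \<open>Gives inverses in \<Lambda> as matrix equations, the form in which they act on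
  vectors.\<close>

lemma SLZ_subgroup_inverse:
  fixes \<Lambda> :: "(int ^ 'n ^ 'n) set"
  assumes "subgroup \<Lambda> SLZ" "A \<in> \<Lambda>"
  obtains B where "B \<in> \<Lambda>" "A ** B = mat 1" "B ** A = mat 1"
proof -
  interpret SL: group "SLZ :: (int ^ 'n ^ 'n) monoid"
    by (rule group_SLZ)
  have A: "A \<in> carrier SLZ"
    by (rule subgroup.mem_carrier[OF assms])
  show thesis
    using subgroup.m_inv_closed[OF assms] SL.l_inv[OF A] SL.r_inv[OF A]
    by (intro that[of "inv\<^bsub>SLZ\<^esub> A"]) (simp_all only: SLZ_simps)
qed

lemma group_semidirect_Zvec:
  assumes "subgroup \<Lambda> SLZ"
  shows "group (semidirect_Zvec \<Lambda>)"
proof (rule groupI)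
  fix x assume "x \<in> carrier (semidirect_Zvec \<Lambda>)"
  then obtain A v where x: "x = (A, v)" "A \<in> \<Lambda>"
    by auto
  obtain B where B: "B \<in> \<Lambda>" "B ** A = mat 1"
    using SLZ_subgroup_inverse[OF assms \<open>A \<in> \<Lambda>\<close>] .
  then show "\<exists>y\<in>carrier (semidirect_Zvec \<Lambda>). y \<otimes>\<^bsub>semidirect_Zvec \<Lambda>\<^esub> x = \<one>\<^bsub>semidirect_Zvec \<Lambda>\<^esub>"
    by (intro bexI[of _ "(B, - (B *v v))"]) (auto simp: x)
qed (use subgroup.m_closed[OF assms] subgroup.one_closed[OF assms] in
    \<open>auto simp: matrix_mul_assoc matrix_vector_right_distrib matrix_vector_mul_assoc\<close>)

lemma inv_semidirect_Zvec:
  assumes "subgroup \<Lambda> SLZ" "A \<in> \<Lambda>" "B \<in> \<Lambda>" "B ** A = mat 1"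
  shows "inv\<^bsub>semidirect_Zvec \<Lambda>\<^esub> (A, v) = (B, - (B *v v))"
  by (rule group.inv_equality[OF group_semidirect_Zvec[OF assms(1)]]) (use assms in auto)

lemma mat_one_mem: "subgroup \<Lambda> SLZ \<Longrightarrow> mat 1 \<in> \<Lambda>"
  using subgroup.one_closed by fastforce

section \<open>Translation parts, images and sums of subgroups\<close>

lemma subgroup_translation_part:
  assumes \<Lambda>: "subgroup \<Lambda> SLZ" and H: "subgroup H (semidirect_Zvec \<Lambda>)"
  shows "subgroup (translation_part H) Zvec"
proof -
  have "(mat 1, v + w) \<in> H" if "(mat 1, v) \<in> H" "(mat 1, w) \<in> H" for v w
    using subgroup.m_closed[OF H that] by simp
  moreover have "(mat 1, - v) \<in> H" if "(mat 1, v) \<in> H" for v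
    using subgroup.m_inv_closed[OF H that] mat_one_mem[OF \<Lambda>]
    by (simp add: inv_semidirect_Zvec[OF \<Lambda>, where B = "mat 1"])
  ultimately show ?thesis
    using subgroup.one_closed[OF H] by (auto simp: subgroup_Zvec_iff translation_part_def)
qed

lemma subgroup_image_Zvec:
  assumes "subgroup F Zvec"
  shows "subgroup ((*v) A ` F) Zvec"
proof -
  have "0 \<in> (*v) A ` F"
    using assms by (metis subgroup_Zvec_iff image_eqI matrix_vector_mult_0_right)
  moreover have "A *v v + A *v w \<in> (*v) A ` F" if "v \<in> F" "w \<in> F" for v w
    using assms that by (metis subgroup_Zvec_iff image_eqI matrix_vector_right_distrib)
  moreover have "- (A *v v) \<in> (*v) A ` F" if "v \<in> F" for v
  proof -
    have "- (A *v v) = A *v (- v)"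
      using matrix_vector_mult_diff_distrib[of A 0 v] by simp
    then show ?thesis
      using assms that by (simp add: subgroup_Zvec_iff)
  qed
  ultimately show ?thesis
    by (simp add: subgroup_Zvec_iff)
qed

lemma
  assumes F: "subgroup F Zvec" and F': "subgroup F' Zvec"
  shows subgroup_set_plus: "subgroup (F + F') Zvec"
    and subset_set_plus1: "F \<subseteq> F + F'" and subset_set_plus2: "F' \<subseteq> F + F'"
proof -
  have 0: "0 \<in> F" "0 \<in> F'"
    using assms by (auto simp: subgroup_Zvec_iff)
  show "F \<subseteq> F + F'" "F' \<subseteq> F + F'"
    using set_plus_intro[OF _ 0(2)] set_plus_intro[OF 0(1)] by auto
  have "(v + w) + (v' + w') \<in> F + F'" "- (v + w) \<in> F + F'"
    if "v \<in> F" "w \<in> F'" "v' \<in> F" "w' \<in> F'" for v w v' w'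
  proof -
    have "v + v' \<in> F" "w + w' \<in> F'" "- v \<in> F" "- w \<in> F'"
      using assms that by (auto simp: subgroup_Zvec_iff)
    from set_plus_intro[OF this(1,2)] set_plus_intro[OF this(3,4)]
    show "(v + w) + (v' + w') \<in> F + F'" "- (v + w) \<in> F + F'"
      by (simp_all add: algebra_simps)
  qed
  then show "subgroup (F + F') Zvec"
    using set_plus_intro[OF 0] by (auto simp: subgroup_Zvec_iff elim!: set_plus_elim)
qed

section \<open>Subgroups of \<open>\<int>\<^sup>d\<close>\<close>

text \<open>Division with remainder by the least positive element of \<open>M\<close>; the trivial
  subgroup has \<open>m = 0\<close>.\<close>

lemma subgroup_int_cyclic:
  fixes M :: "int set"
  assumes "0 \<in> M" and diff: "\<And>a b. a \<in> M \<Longrightarrow> b \<in> M \<Longrightarrow> a - b \<in> M"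
  obtains m where "m \<in> M" "\<And>a. a \<in> M \<Longrightarrow> m dvd a"
proof (cases "M = {0}")
  case True
  with that[of 0] show thesis by simp
next
  case False
  have neg: "- a \<in> M" if "a \<in> M" for a
    using diff[OF \<open>0 \<in> M\<close> that] by simp
  have "\<exists>k. 0 < k \<and> int k \<in> M"
  proof -
    obtain a where "a \<in> M" "a \<noteq> 0"
      using False \<open>0 \<in> M\<close> by blast
    with neg[of a] have "\<bar>a\<bar> \<in> M"
      by (auto simp: abs_if)
    with \<open>a \<noteq> 0\<close> show ?thesis
      by (intro exI[of _ "nat \<bar>a\<bar>"]) simp
  qed
  then obtain k where k: "0 < k" "int k \<in> M" and least: "\<And>j. 0 < j \<Longrightarrow> int j \<in> M \<Longrightarrow> k \<le> j"
    using exists_least_iff[of "\<lambda>k. 0 < k \<and> int k \<in> M"] by (metis not_le)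
  have "int k dvd a" if "a \<in> M" for a
  proof -
    have mult: "int j * int k \<in> M" for j
    proof (induction j)
      case (Suc j)
      then show ?case
        using diff[OF Suc.IH neg[OF k(2)]] by (simp add: algebra_simps)
    qed (use \<open>0 \<in> M\<close> in simp)
    have "q * int k \<in> M" for q
      by (cases q rule: int_cases2) (use mult neg in auto)
    then have "a mod int k \<in> M"
      using diff[OF that] by (metis minus_div_mult_eq_mod)
    \<comment> \<open>A positive remainder would be an element of \<open>M\<close> smaller than
      \<open>k\<close>.\<close>
    then have "\<not> 0 < a mod int k"
      using least[of "nat (a mod int k)"] k(1) pos_mod_bound[of "int k" a]
      by (auto simp: le_nat_iff simp del: pos_mod_bound)
    moreover have "0 \<le> a mod int k"
      using k(1) by simp
    ultimately show ?thesis
      by (simp add: dvd_eq_mod_eq_0)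
  qed
  with k(2) that show thesis by blast
qed

text \<open>Induction on the coordinates in the support: the values of one coordinate on
  \<open>K\<close> form a cyclic group, so one vector realising its generator, together with
  generators of the subgroup where that coordinate vanishes, generates \<open>K\<close>. Each
  coordinate costs at most one generator.\<close>

lemma subgroup_Zvec_supported_finitely_generated:
  fixes K :: "(int ^ 'n) set"
  assumes "finite I" "subgroup K Zvec" "\<And>v i. v \<in> K \<Longrightarrow> i \<notin> I \<Longrightarrow> v $ i = 0"
  shows "\<exists>S. finite S \<and> card S \<le> card I \<and> S \<subseteq> K \<and> K \<subseteq> generate Zvec S"
  using assms
proof (induction I arbitrary: K rule: finite_induct)
  case empty
  then have "K \<subseteq> {0}"
    by (auto simp: vec_eq_iff)
  then show ?case
    using generate.one[of Zvec] by (intro exI[of _ "{}"]) auto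
next
  case (insert i I)
  interpret Z: group "Zvec :: (int ^ 'n) monoid"
    by (rule group_Zvec)
  note K = insert.prems(1)
  define K' where "K' = {v \<in> K. v $ i = 0}"
  have "subgroup K' Zvec"
    using K by (auto simp: subgroup_Zvec_iff K'_def)
  moreover have "v $ j = 0" if "v \<in> K'" "j \<notin> I" for v j
    using insert.prems(2)[of v j] that by (cases "j = i") (auto simp: K'_def)
  ultimately obtain S where S: "finite S" "card S \<le> card I" "S \<subseteq> K'" "K' \<subseteq> generate Zvec S"
    using insert.IH by blast
  obtain m where m: "m \<in> (\<lambda>v. v $ i) ` K" "\<And>a. a \<in> (\<lambda>v. v $ i) ` K \<Longrightarrow> m dvd a"
  proof (rule subgroup_int_cyclic[of "(\<lambda>v. v $ i) ` K"])
    have "(0 :: int ^ 'n) \<in> K"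
      using K by (simp add: subgroup_Zvec_iff)
    then show "0 \<in> (\<lambda>v. v $ i) ` K"
      by (intro image_eqI[of _ _ 0]) simp_all
    show "a - b \<in> (\<lambda>v. v $ i) ` K" if "a \<in> (\<lambda>v. v $ i) ` K" "b \<in> (\<lambda>v. v $ i) ` K" for a b
      using that subgroup_Zvec_diff[OF K] by (auto simp: image_iff simp flip: vector_minus_component)
  qed blast
  then obtain u where u: "u \<in> K" "u $ i = m"
    by auto
  have gen: "subgroup (generate Zvec (insert u S)) Zvec"
    by (rule Z.generate_is_subgroup) simp
  have "v \<in> generate Zvec (insert u S)" if "v \<in> K" for v
  proof -
    obtain c where "v $ i = m * c"
      using m(2)[of "v $ i"] \<open>v \<in> K\<close> by (auto elim: dvdE)
    then have "v - c *s u \<in> K'"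
      using subgroup_Zvec_diff[OF K \<open>v \<in> K\<close> subgroup_Zvec_scale[OF K u(1)]] u(2)
      by (simp add: K'_def)
    then have "v - c *s u \<in> generate Zvec (insert u S)"
      using S(4) Z.mono_generate[of S "insert u S"] by auto
    moreover have "c *s u \<in> generate Zvec (insert u S)"
      by (intro subgroup_Zvec_scale[OF gen] generate.incl) simp
    ultimately have "(v - c *s u) + c *s u \<in> generate Zvec (insert u S)"
      using gen unfolding subgroup_Zvec_iff by blast
    then show ?thesis by simp
  qed
  moreover have "card (insert u S) \<le> card (insert i I)"
    using S(1,2) insert.hyps by (simp add: card_insert_if)
  ultimately show ?case
    using S u(1) by (intro exI[of _ "insert u S"]) (auto simp: K'_def)
qed

lemma subgroup_Zvec_finitely_generated:
  fixes K :: "(int ^ 'n) set"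
  assumes "subgroup K Zvec"
  obtains S where "finite S" "card S \<le> CARD('n)" "S \<subseteq> K" "generate Zvec S = K"
proof -
  obtain S where S: "finite S" "card S \<le> CARD('n)" "S \<subseteq> K" "K \<subseteq> generate Zvec S"
    using subgroup_Zvec_supported_finitely_generated[of UNIV K] assms by auto
  moreover have "generate Zvec S \<subseteq> K"
    by (rule group.generate_subgroup_incl[OF group_Zvec \<open>S \<subseteq> K\<close> assms])
  ultimately show thesis
    using that by blast
qed

text \<open>Noetherianity through Zorn's lemma: the union of a chain is a finitely generated
  subgroup, its generators already lie in one member of the chain, and that member is then the
  union.\<close>

lemma subgroups_Zvec_maximal_element:
  fixes \<K> :: "(int ^ 'n) set set"
  assumes "\<K> \<noteq> {}" and sub: "\<And>K. K \<in> \<K> \<Longrightarrow> subgroup K Zvec"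
  shows "\<exists>F\<in>\<K>. \<forall>K\<in>\<K>. F \<subseteq> K \<longrightarrow> K = F"
proof (rule subset_Zorn_nonempty[OF assms(1)])
  fix \<C> assume \<C>: "\<C> \<noteq> {}" "subset.chain \<K> \<C>"
  then have "\<C> \<subseteq> \<K>" and chain: "\<And>X Y. X \<in> \<C> \<Longrightarrow> Y \<in> \<C> \<Longrightarrow> X \<subseteq> Y \<or> Y \<subseteq> X"
    by (auto simp: subset_chain_def)
  with sub have sub': "\<And>K. K \<in> \<C> \<Longrightarrow> subgroup K Zvec"
    by blast
  have "v + w \<in> \<Union>\<C>" if "v \<in> X" "X \<in> \<C>" "w \<in> Y" "Y \<in> \<C>" for v w X Y
    using chain[OF that(2,4)] that sub'[unfolded subgroup_Zvec_iff] by blast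
  moreover have "0 \<in> \<Union>\<C>" "\<And>v. v \<in> \<Union>\<C> \<Longrightarrow> - v \<in> \<Union>\<C>"
    using \<open>\<C> \<noteq> {}\<close> sub'[unfolded subgroup_Zvec_iff] by blast+
  ultimately have "subgroup (\<Union>\<C>) Zvec"
    unfolding subgroup_Zvec_iff by blast
  then obtain S where S: "finite S" "S \<subseteq> \<Union>\<C>" "generate Zvec S = \<Union>\<C>"
    by (rule subgroup_Zvec_finitely_generated)
  obtain B where "B \<in> \<C>" "S \<subseteq> B"
    using finite_subset_Union_chain[OF S(1,2) \<C>] .
  then have "\<Union>\<C> \<subseteq> B"
    using group.generate_subgroup_incl[OF group_Zvec \<open>S \<subseteq> B\<close> sub'] S(3) by simp
  with \<open>B \<in> \<C>\<close> have "\<Union>\<C> = B"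
    by blast
  with \<open>B \<in> \<C>\<close> \<open>\<C> \<subseteq> \<K>\<close> show "\<Union>\<C> \<in> \<K>"
    by blast
qed

section \<open>Almost disjoint events\<close>

text \<open>A Bonferroni-type bound. When the sets are added one at a time, each new set meets the
  union of the earlier ones in at most \<open>m\<close> points per earlier set.\<close>

lemma sum_card_le_of_small_intersections:
  assumes "finite I" "finite X" "\<And>i. i \<in> I \<Longrightarrow> A i \<subseteq> X"
    and "\<And>i j. i \<in> I \<Longrightarrow> j \<in> I \<Longrightarrow> i \<noteq> j \<Longrightarrow> real (card (A i \<inter> A j)) \<le> m" and "0 \<le> m"
  shows "(\<Sum>i\<in>I. real (card (A i))) \<le> real (card X) + (real (card I))\<^sup>2 * m"
proof -
  have fin: "finite (A i)" if "i \<in> I" for i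
    using assms(2,3) that finite_subset by blast
  have "(\<Sum>i\<in>I. real (card (A i))) \<le> real (card (\<Union>i\<in>I. A i)) + (real (card I))\<^sup>2 * m"
    using assms(1,4) fin
  proof (induction I rule: finite_induct)
    case (insert k I)
    let ?U = "\<Union>i\<in>I. A i"
    have "finite ?U" "finite (A k)"
      using insert by auto
    have "real (card (A k \<inter> ?U)) \<le> (\<Sum>i\<in>I. real (card (A k \<inter> A i)))"
    proof -
      have "card (\<Union>i\<in>I. A k \<inter> A i) \<le> (\<Sum>i\<in>I. card (A k \<inter> A i))"
        by (rule card_UN_le[OF insert.hyps(1)])
      moreover have "(\<Union>i\<in>I. A k \<inter> A i) = A k \<inter> ?U"
        by blast
      ultimately show ?thesis
        unfolding of_nat_sum[symmetric] by (simp only: of_nat_le_iff)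
    qed
    also have "\<dots> \<le> real (card I) * m"
      by (rule sum_bounded_above) (use insert in auto)
    finally have "real (card (A k)) + real (card ?U) \<le> real (card (A k \<union> ?U)) + real (card I) * m"
      using card_Un_Int[OF \<open>finite (A k)\<close> \<open>finite ?U\<close>] by linarith
    moreover have "(\<Sum>i\<in>I. real (card (A i))) \<le> real (card ?U) + (real (card I))\<^sup>2 * m"
      using insert by auto
    \<comment> \<open>The quadratic error term absorbs the linear one, as k^2 + k \<le> (k +
      1)^2.\<close>
    moreover have "(real (card I))\<^sup>2 * m + real (card I) * m \<le> (real (Suc (card I)))\<^sup>2 * m"
      using \<open>0 \<le> m\<close> by (simp add: power2_eq_square algebra_simps)
    ultimately show ?case
      using insert.hyps by (simp add: add.commute)
  qed simp
  also have "card (\<Union>i\<in>I. A i) \<le> card X"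
    using assms by (intro card_mono) auto
  finally show ?thesis by simp
qed

text \<open>Any k of the events have total size \<open>k * c n\<close>, which up to vanishing
  overlaps fits into \<open>X n\<close>; so the proportion is eventually at most about 1/k, for
  every k.\<close>

lemma infinitely_many_almost_disjoint_imp_null:
  fixes X :: "nat \<Rightarrow> 'a set" and E :: "'i \<Rightarrow> nat \<Rightarrow> 'a set"
  assumes "infinite I"
    and X: "\<And>n. finite (X n)" "\<And>n. X n \<noteq> {}"
    and E: "\<And>i n. i \<in> I \<Longrightarrow> E i n \<subseteq> X n" "\<And>i n. i \<in> I \<Longrightarrow> card (E i n) = c n"
    and disj: "\<And>i j. i \<in> I \<Longrightarrow> j \<in> I \<Longrightarrow> i \<noteq> j \<Longrightarrow>
        (\<lambda>n. real (card (E i n \<inter> E j n)) / real (card (X n))) \<longlonglongrightarrow> 0"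
  shows "(\<lambda>n. real (c n) / real (card (X n))) \<longlonglongrightarrow> 0"
proof (rule LIMSEQ_I)
  fix \<epsilon> :: real assume "0 < \<epsilon>"
  \<comment> \<open>With k > 2/\<epsilon> and overlaps of proportion below 1/k^2, the error term is
    at most \<open>card (X n)\<close>, whence \<open>k * c n \<le> 2 * card (X n)\<close>.\<close>
  obtain k :: nat where k: "2 / \<epsilon> < real k"
    using reals_Archimedean2 by blast
  with \<open>0 < \<epsilon>\<close> have "0 < real k"
    by (meson divide_pos_pos less_trans zero_less_numeral)
  obtain J where J: "J \<subseteq> I" "finite J" "card J = k"
    using infinite_arbitrarily_large[OF \<open>infinite I\<close>] by blast
  define \<delta> where "\<delta> = 1 / (real k)\<^sup>2"
  have "0 < \<delta>"
    using \<open>0 < real k\<close> by (simp add: \<delta>_def)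
  \<comment> \<open>The finite set \<open>J\<close> has finitely many pairs, so a single
    \<open>N\<close> serves all of them.\<close>
  have "\<forall>\<^sub>F n in sequentially. \<forall>p\<in>{p \<in> J \<times> J. fst p \<noteq> snd p}.
      real (card (E (fst p) n \<inter> E (snd p) n)) / real (card (X n)) < \<delta>"
    by (intro eventually_ball_finite ballI order_tendstoD(2)[OF disj \<open>0 < \<delta>\<close>])
      (use J in auto)
  then obtain N where N: "\<And>n p. n \<ge> N \<Longrightarrow> p \<in> J \<times> J \<Longrightarrow> fst p \<noteq> snd p \<Longrightarrow>
      real (card (E (fst p) n \<inter> E (snd p) n)) / real (card (X n)) < \<delta>"
    unfolding eventually_sequentially by blast
  have "real (c n) / real (card (X n)) < \<epsilon>" if "n \<ge> N" for n
  proof -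
    have pos: "0 < real (card (X n))"
      using X by (simp add: card_gt_0_iff)
    have "(\<Sum>i\<in>J. real (card (E i n))) \<le> real (card (X n)) + (real (card J))\<^sup>2 * (\<delta> * real (card (X n)))"
    proof (rule sum_card_le_of_small_intersections)
      show "real (card (E i n \<inter> E j n)) \<le> \<delta> * real (card (X n))" if "i \<in> J" "j \<in> J" "i \<noteq> j" for i j
        using N[OF \<open>n \<ge> N\<close>, of "(i, j)"] that pos by (simp add: field_simps)
    qed (use J E X \<open>0 < \<delta>\<close> in auto)
    also have "(\<Sum>i\<in>J. real (card (E i n))) = real k * real (c n)"
      using J E(2) by (subst sum.cong[OF refl, of _ _ "\<lambda>_. real (c n)"]) auto
    also have "real (card (X n)) + (real (card J))\<^sup>2 * (\<delta> * real (card (X n))) = 2 * real (card (X n))"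
      using \<open>0 < real k\<close> J by (simp add: \<delta>_def)
    finally have "real (c n) / real (card (X n)) \<le> 2 / real k"
      using \<open>0 < real k\<close> pos by (simp add: field_simps)
    also have "\<dots> < \<epsilon>"
      using k \<open>0 < \<epsilon>\<close> \<open>0 < real k\<close> by (simp add: field_simps)
    finally show ?thesis .
  qed
  then show "\<exists>N. \<forall>n\<ge>N. norm (real (c n) / real (card (X n)) - 0) < \<epsilon>"
    by auto
qed

section \<open>Fixed cosets\<close>

text \<open>\<open>S\<close> is a set so that one notion covers single elements as well as whole
  subgroups of translations.\<close>

definition fixed_cosets :: "('a, 'b) monoid_scheme \<Rightarrow> 'a set \<Rightarrow> 'a set \<Rightarrow> 'a set set" where
  "fixed_cosets G H S = {c \<in> lcosets\<^bsub>G\<^esub> H. \<forall>g\<in>S. g <#\<^bsub>G\<^esub> c = c}"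

lemma fixed_cosets_subset: "fixed_cosets G H S \<subseteq> lcosets\<^bsub>G\<^esub> H"
  by (auto simp: fixed_cosets_def)

context group
begin

lemma l_coset_eq_iff:
  assumes "subgroup H G" "a \<in> carrier G" "b \<in> carrier G"
  shows "a <# H = b <# H \<longleftrightarrow> inv a \<otimes> b \<in> H"
proof
  assume "a <# H = b <# H"
  then have "b \<in> a <# H"
    using lcos_self[OF assms(3,1)] by simp
  then show "inv a \<otimes> b \<in> H"
    using subgroup.lcos_module_imp[OF assms(1) is_group assms(2)] by blast
next
  assume "inv a \<otimes> b \<in> H"
  then have "b \<in> a <# H"
    using subgroup.lcos_module_rev[OF assms(1) is_group assms(2,3)] by blast
  then show "a <# H = b <# H"
    by (rule l_repr_independence[OF _ assms(2,1)])
qed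

lemma lcosetsE:
  assumes "c \<in> lcosets H"
  obtains a where "a \<in> carrier G" "c = a <# H"
  using assms by (auto simp: LCOSETS_def)

lemma l_coset_in_lcosets: "a \<in> carrier G \<Longrightarrow> a <# H \<in> lcosets H"
  by (auto simp: LCOSETS_def)

context
  fixes H
  assumes H: "subgroup H G"
begin

lemma lcosets_nonempty: "lcosets H \<noteq> {}"
  using l_coset_in_lcosets[OF one_closed] by blast

lemma lcosets_translate:
  assumes "g \<in> carrier G" "c \<in> lcosets H"
  shows "g <# c \<in> lcosets H"
proof -
  obtain a where "a \<in> carrier G" "c = a <# H"
    by (rule lcosetsE[OF assms(2)])
  then show ?thesis
    using lcos_m_assoc[OF subgroup.subset[OF H] assms(1), of a] assms(1)
    by (simp add: l_coset_in_lcosets)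
qed

lemma lcosets_assoc:
  assumes "g \<in> carrier G" "h \<in> carrier G" "c \<in> lcosets H"
  shows "g <# (h <# c) = (g \<otimes> h) <# c"
  using lcos_m_assoc assms subgroup.lcosets_carrier[OF H is_group] by blast

lemma lcosets_one: "c \<in> lcosets H \<Longrightarrow> \<one> <# c = c"
  using lcos_mult_one subgroup.lcosets_carrier[OF H is_group] by blast

lemma lcosets_translate_inv:
  assumes "g \<in> carrier G" "c \<in> lcosets H"
  shows "inv g <# (g <# c) = c" "g <# (inv g <# c) = c"
  using assms by (simp_all add: lcosets_assoc lcosets_one)

text \<open>The bijection is translation by \<open>a\<close>: the conjugate of \<open>g\<close> by
  \<open>a\<close> fixes the translate of \<open>c\<close> exactly when \<open>g\<close> fixes
  \<open>c\<close>.\<close>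

lemma card_fixed_cosets_conjugate:
  assumes a: "a \<in> carrier G" and S: "S \<subseteq> carrier G"
  shows "card (fixed_cosets G H ((\<lambda>g. a \<otimes> g \<otimes> inv a) ` S)) = card (fixed_cosets G H S)"
proof -
  have fixed_iff: "(a \<otimes> g \<otimes> inv a) <# (a <# c) = a <# c \<longleftrightarrow> g <# c = c"
    if "g \<in> S" "c \<in> lcosets H" for g c
  proof -
    have g: "g \<in> carrier G"
      using S that by auto
    have "(a \<otimes> g \<otimes> inv a) <# (a <# c) = (a \<otimes> g \<otimes> inv a \<otimes> a) <# c"
      using a g that by (simp add: lcosets_assoc)
    also have "\<dots> = a <# (g <# c)"
      using a g that by (simp add: lcosets_assoc m_assoc)
    finally have "(a \<otimes> g \<otimes> inv a) <# (a <# c) = a <# (g <# c)" .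
    moreover have "a <# (g <# c) = a <# c \<longleftrightarrow> g <# c = c"
      using lcosets_translate_inv(1)[OF a] lcosets_translate[OF g] that by metis
    ultimately show ?thesis by simp
  qed
  have "bij_betw (\<lambda>c. a <# c) (fixed_cosets G H S) (fixed_cosets G H ((\<lambda>g. a \<otimes> g \<otimes> inv a) ` S))"
  proof (rule bij_betw_byWitness[where f' = "\<lambda>c. inv a <# c"])
    show "(\<lambda>c. a <# c) ` fixed_cosets G H S \<subseteq> fixed_cosets G H ((\<lambda>g. a \<otimes> g \<otimes> inv a) ` S)"
      using fixed_iff lcosets_translate[OF a] by (simp add: fixed_cosets_def image_subset_iff)
    show "(\<lambda>c. inv a <# c) ` fixed_cosets G H ((\<lambda>g. a \<otimes> g \<otimes> inv a) ` S) \<subseteq> fixed_cosets G H S"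
    proof clarify
      fix c assume c: "c \<in> fixed_cosets G H ((\<lambda>g. a \<otimes> g \<otimes> inv a) ` S)"
      then have "c \<in> lcosets H"
        by (auto simp: fixed_cosets_def)
      then have "inv a <# c \<in> lcosets H" "a <# (inv a <# c) = c"
        using a lcosets_translate lcosets_translate_inv by auto
      then show "inv a <# c \<in> fixed_cosets G H S"
        using c fixed_iff[of _ "inv a <# c"] by (simp add: fixed_cosets_def)
    qed
  qed (use lcosets_translate_inv[OF a] in \<open>auto simp: fixed_cosets_def\<close>)
  then show ?thesis
    by (simp add: bij_betw_same_card)
qed

end

end

section \<open>Cosets and indices in Z^d\<close>

lemma mem_l_coset_Zvec: "x \<in> v <#\<^bsub>Zvec\<^esub> K \<longleftrightarrow> x - v \<in> K"
  by (force simp: l_coset_def algebra_simps)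

lemma lcosets_Zvec: "lcosets\<^bsub>Zvec\<^esub> K = range (\<lambda>v. v <#\<^bsub>Zvec\<^esub> K)"
  by (auto simp: LCOSETS_def)

text \<open>Multiplication by \<open>A\<close> maps each coset of \<open>F\<close> into a coset of
  \<open>L\<close>, and surjectivity of \<open>A\<close> makes the induced map on cosets
  surjective.\<close>

lemma subgroup_index_Zvec_le:
  assumes L: "subgroup L Zvec" and "finite_index Zvec F"
    and "surj ((*v) A)" and sub: "(*v) A ` F \<subseteq> L" and "subgroup F Zvec"
  shows "subgroup_index Zvec L \<le> subgroup_index Zvec F"
proof -
  \<comment> \<open>The induced map is written as a union over all members \<open>c\<close> of a
    coset instead of choosing a representative; every \<open>c\<close> contributes the same coset of
    \<open>L\<close>.\<close>
  have "lcosets\<^bsub>Zvec\<^esub> L \<subseteq> (\<lambda>C. \<Union>c\<in>C. (A *v c) <#\<^bsub>Zvec\<^esub> L) ` (lcosets\<^bsub>Zvec\<^esub> F)"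
  proof
    fix D assume "D \<in> lcosets\<^bsub>Zvec\<^esub> L"
    then obtain y where D: "D = (A *v y) <#\<^bsub>Zvec\<^esub> L"
      using surjD[OF \<open>surj ((*v) A)\<close>] by (auto simp: lcosets_Zvec) metis
    have "(A *v c) <#\<^bsub>Zvec\<^esub> L = D" if "c \<in> y <#\<^bsub>Zvec\<^esub> F" for c
    proof -
      have "A *v c - A *v y \<in> L"
        using that sub by (auto simp: mem_l_coset_Zvec simp flip: matrix_vector_mult_diff_distrib)
      then show ?thesis
        unfolding D using L
        by (subst group.l_coset_eq_iff[OF group_Zvec])
          (auto dest: subgroup_Zvec_diff[OF L, of 0] simp: subgroup_Zvec_iff)
    qed
    moreover have "y \<in> y <#\<^bsub>Zvec\<^esub> F"
      using \<open>subgroup F Zvec\<close> by (simp add: mem_l_coset_Zvec subgroup_Zvec_iff)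
    ultimately have "(\<Union>c\<in>y <#\<^bsub>Zvec\<^esub> F. (A *v c) <#\<^bsub>Zvec\<^esub> L) = D"
      by blast
    then show "D \<in> (\<lambda>C. \<Union>c\<in>C. (A *v c) <#\<^bsub>Zvec\<^esub> L) ` (lcosets\<^bsub>Zvec\<^esub> F)"
      by (intro image_eqI[of _ _ "y <#\<^bsub>Zvec\<^esub> F"]) (auto simp: lcosets_Zvec)
  qed
  then show ?thesis
    using assms(2) by (auto simp: subgroup_index_def finite_index_def intro: surj_card_le)
qed

section \<open>Elements of the semidirect product fix few cosets\<close>

abbreviation translation_set :: "(int ^ 'n) set \<Rightarrow> ((int ^ 'n ^ 'n) \<times> (int ^ 'n)) set" where
  "translation_set F \<equiv> Pair (mat 1) ` F"

locale integral_affine_group =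
  fixes \<Lambda> :: "(int ^ 'n ^ 'n) set" and \<Gamma> :: "((int ^ 'n ^ 'n) \<times> (int ^ 'n)) monoid"
  assumes subgroup_\<Lambda>: "subgroup \<Lambda> SLZ"
  defines "\<Gamma> \<equiv> semidirect_Zvec \<Lambda>"
begin

lemma \<Gamma>_simps [simp]:
  "carrier \<Gamma> = \<Lambda> \<times> UNIV"
  "(A, v) \<otimes>\<^bsub>\<Gamma>\<^esub> (B, w) = (A ** B, v + A *v w)"
  "\<one>\<^bsub>\<Gamma>\<^esub> = (mat 1, 0)"
  by (simp_all add: \<Gamma>_def)

sublocale \<Gamma>: group \<Gamma>
  unfolding \<Gamma>_def by (rule group_semidirect_Zvec[OF subgroup_\<Lambda>])

lemma one_mem [simp]: "mat 1 \<in> \<Lambda>"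
  by (rule mat_one_mem[OF subgroup_\<Lambda>])

lemma inv_translation: "inv\<^bsub>\<Gamma>\<^esub> (mat 1, v) = (mat 1, - v)"
  unfolding \<Gamma>_def using inv_semidirect_Zvec[OF subgroup_\<Lambda>, of "mat 1" "mat 1"] by simp

text \<open>Lets a coset fixed by some translations be treated as fixed by everything they generate,
  sums of subgroups included.\<close>

lemma subgroup_stabilizer_translations:
  assumes "subgroup H \<Gamma>" "c \<in> lcosets\<^bsub>\<Gamma>\<^esub> H"
  shows "subgroup {v. (mat 1, v) <#\<^bsub>\<Gamma>\<^esub> c = c} Zvec"
proof -
  have "(mat 1, v + w) <#\<^bsub>\<Gamma>\<^esub> c = c"
    if "(mat 1, v) <#\<^bsub>\<Gamma>\<^esub> c = c" "(mat 1, w) <#\<^bsub>\<Gamma>\<^esub> c = c" for v w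
    using \<Gamma>.lcosets_assoc[OF assms(1) _ _ assms(2), of "(mat 1, v)" "(mat 1, w)"] that by simp
  moreover have "(mat 1, - v) <#\<^bsub>\<Gamma>\<^esub> c = c" if "(mat 1, v) <#\<^bsub>\<Gamma>\<^esub> c = c" for v
    using \<Gamma>.lcosets_translate_inv(1)[OF assms(1) _ assms(2), of "(mat 1, v)"] that
    by (simp add: inv_translation)
  moreover have "(mat 1, 0) <#\<^bsub>\<Gamma>\<^esub> c = c"
    using \<Gamma>.lcosets_one[OF assms] by simp
  ultimately show ?thesis
    by (simp add: subgroup_Zvec_iff)
qed

lemma fixed_cosets_translations:
  "fixed_cosets \<Gamma> H (translation_set F) =
     {c \<in> lcosets\<^bsub>\<Gamma>\<^esub> H. F \<subseteq> {v. (mat 1, v) <#\<^bsub>\<Gamma>\<^esub> c = c}}"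
  by (auto simp: fixed_cosets_def)

text \<open>The translations fixing a coset form a subgroup, which contains \<open>F\<close> and
  \<open>F'\<close> exactly when it contains their sum.\<close>

lemma fixed_cosets_set_plus:
  assumes H: "subgroup H \<Gamma>" and F: "subgroup F Zvec" and F': "subgroup F' Zvec"
  shows "fixed_cosets \<Gamma> H (translation_set (F + F')) =
    fixed_cosets \<Gamma> H (translation_set F) \<inter> fixed_cosets \<Gamma> H (translation_set F')"
proof -
  have "F + F' \<subseteq> {v. (mat 1, v) <#\<^bsub>\<Gamma>\<^esub> c = c} \<longleftrightarrow>
      F \<subseteq> {v. (mat 1, v) <#\<^bsub>\<Gamma>\<^esub> c = c} \<and> F' \<subseteq> {v. (mat 1, v) <#\<^bsub>\<Gamma>\<^esub> c = c}"
    (is "?L \<longleftrightarrow> ?R") if c: "c \<in> lcosets\<^bsub>\<Gamma>\<^esub> H" for c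
  proof
    show ?R if ?L
      using that subset_set_plus1[OF F F'] subset_set_plus2[OF F F'] by blast
    show ?L if ?R
      using that subgroup_stabilizer_translations[OF H c]
      by (auto simp: subgroup_Zvec_iff subset_iff elim!: set_plus_elim)
  qed
  then show ?thesis
    unfolding fixed_cosets_translations by blast
qed

text \<open>Conjugation by \<open>(A, 0)\<close> turns translation by \<open>v\<close> into
  translation by \<open>A *v v\<close>, so this is a case of invariance under conjugation.\<close>

lemma card_fixed_cosets_image:
  assumes H: "subgroup H \<Gamma>" and A: "A \<in> \<Lambda>"
  shows "card (fixed_cosets \<Gamma> H (translation_set ((*v) A ` F))) =
    card (fixed_cosets \<Gamma> H (translation_set F))"
proof -
  obtain B where B: "B \<in> \<Lambda>" "A ** B = mat 1" "B ** A = mat 1"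
    using SLZ_subgroup_inverse[OF subgroup_\<Lambda> A] .
  have inv: "inv\<^bsub>\<Gamma>\<^esub> (A, 0) = (B, 0)"
    unfolding \<Gamma>_def using inv_semidirect_Zvec[OF subgroup_\<Lambda> A B(1,3), of 0] by simp
  have "translation_set ((*v) A ` F) =
      (\<lambda>g. (A, 0) \<otimes>\<^bsub>\<Gamma>\<^esub> g \<otimes>\<^bsub>\<Gamma>\<^esub> inv\<^bsub>\<Gamma>\<^esub> (A, 0)) ` translation_set F"
    by (auto simp: image_image inv B)
  moreover have "translation_set F \<subseteq> carrier \<Gamma>"
    by auto
  ultimately show ?thesis
    using \<Gamma>.card_fixed_cosets_conjugate[OF H, of "(A, 0)" "translation_set F"] A by simp
qed

text \<open>If \<open>F\<close> fixes the coset of \<open>(B, w)\<close>, conjugating back by this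
  element moves \<open>F\<close>, transformed by the inverse of \<open>B\<close>, into the
  translation part of \<open>H\<close>. Read contrapositively, a large index of the translation part
  leaves no coset fixed by \<open>F\<close>.\<close>

lemma index_le_of_fixed_coset:
  assumes H: "subgroup H \<Gamma>" and F: "subgroup F Zvec" "finite_index Zvec F"
    and "fixed_cosets \<Gamma> H (translation_set F) \<noteq> {}"
  shows "subgroup_index Zvec (translation_part H) \<le> subgroup_index Zvec F"
proof -
  obtain c where "c \<in> lcosets\<^bsub>\<Gamma>\<^esub> H" and fixed: "\<And>v. v \<in> F \<Longrightarrow> (mat 1, v) <#\<^bsub>\<Gamma>\<^esub> c = c"
    using assms(4) by (auto simp: fixed_cosets_translations)
  then obtain B w where B: "B \<in> \<Lambda>" and c: "c = (B, w) <#\<^bsub>\<Gamma>\<^esub> H"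
    using \<Gamma>.lcosetsE[of c H] by (metis SigmaE \<Gamma>_simps(1))
  obtain B' where B': "B' \<in> \<Lambda>" "B ** B' = mat 1" "B' ** B = mat 1"
    using SLZ_subgroup_inverse[OF subgroup_\<Lambda> B] .
  have inv: "inv\<^bsub>\<Gamma>\<^esub> (B, w) = (B', - (B' *v w))"
    unfolding \<Gamma>_def using inv_semidirect_Zvec[OF subgroup_\<Lambda> B B'(1,3)] .
  have "B' *v v \<in> translation_part H" if "v \<in> F" for v
  proof -
    have "(B, w) <#\<^bsub>\<Gamma>\<^esub> H = (B, v + w) <#\<^bsub>\<Gamma>\<^esub> H"
      using fixed[OF that] \<Gamma>.lcos_m_assoc[OF subgroup.subset[OF H], of "(mat 1, v)" "(B, w)"] B
      by (simp add: c)
    \<comment> \<open>The product is translation by \<open>v\<close> conjugated by the inverse of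
      \<open>(B, w)\<close>, that is, translation by \<open>B' *v v\<close>.\<close>
    then have "inv\<^bsub>\<Gamma>\<^esub> (B, w) \<otimes>\<^bsub>\<Gamma>\<^esub> (B, v + w) \<in> H"
      using B by (subst (asm) \<Gamma>.l_coset_eq_iff[OF H]) auto
    then show ?thesis
      using B' by (simp add: inv translation_part_def matrix_vector_right_distrib)
  qed
  then have "(*v) B' ` F \<subseteq> translation_part H"
    by blast
  moreover have "surj ((*v) B')"
    using B'(3) by (intro surjI[of _ "(*v) B"]) (simp add: matrix_vector_mul_assoc)
  moreover have "subgroup (translation_part H) Zvec"
    by (rule subgroup_translation_part[OF subgroup_\<Lambda> H[unfolded \<Gamma>_def]])
  ultimately show ?thesis
    using subgroup_index_Zvec_le F by blast
qed

end

section \<open>Proportions of fixed cosets along the sequence of subgroups\<close>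

locale integral_affine_subgroups = integral_affine_group +
  fixes \<Gamma>s :: "nat \<Rightarrow> ((int ^ 'n ^ 'n) \<times> (int ^ 'n)) set"
  assumes irreducible: "Z_strongly_irreducible \<Lambda>"
    and subgroup_\<Gamma>s: "\<And>n. subgroup (\<Gamma>s n) \<Gamma>"
    and finite_index_\<Gamma>s: "\<And>n. finite_index \<Gamma> (\<Gamma>s n)"
    and index_at_top:
      "filterlim (\<lambda>n. subgroup_index Zvec (translation_part (\<Gamma>s n))) at_top sequentially"
begin

text \<open>For \<open>S = translation_set F\<close> this is the proportion called P_n(F) in the
  outline.\<close>

definition fixed_ratio :: "((int ^ 'n ^ 'n) \<times> (int ^ 'n)) set \<Rightarrow> nat \<Rightarrow> real" where
  "fixed_ratio S n =
     real (card (fixed_cosets \<Gamma> (\<Gamma>s n) S)) / real (card (lcosets\<^bsub>\<Gamma>\<^esub> (\<Gamma>s n)))"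

lemma finite_lcosets: "finite (lcosets\<^bsub>\<Gamma>\<^esub> (\<Gamma>s n))"
  using finite_index_\<Gamma>s by (simp add: finite_index_def)

lemma finite_fixed_cosets: "finite (fixed_cosets \<Gamma> (\<Gamma>s n) S)"
  using finite_subset[OF fixed_cosets_subset finite_lcosets] .

lemma fixed_ratio_null_mono:
  assumes "fixed_ratio S \<longlonglongrightarrow> 0" "\<And>n. E n \<subseteq> fixed_cosets \<Gamma> (\<Gamma>s n) S"
  shows "(\<lambda>n. real (card (E n)) / real (card (lcosets\<^bsub>\<Gamma>\<^esub> (\<Gamma>s n)))) \<longlonglongrightarrow> 0"
proof (rule tendsto_sandwich[OF _ _ tendsto_const assms(1)])
  show "\<forall>\<^sub>F n in sequentially. real (card (E n)) / real (card (lcosets\<^bsub>\<Gamma>\<^esub> (\<Gamma>s n))) \<le> fixed_ratio S n"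
    unfolding fixed_ratio_def using assms(2) finite_fixed_cosets
    by (intro always_eventually allI divide_right_mono of_nat_mono card_mono) auto
qed auto

lemma fixed_ratio_image:
  "A \<in> \<Lambda> \<Longrightarrow> fixed_ratio (translation_set ((*v) A ` F)) = fixed_ratio (translation_set F)"
  by (simp add: fixed_ratio_def fun_eq_iff card_fixed_cosets_image[OF subgroup_\<Gamma>s])

lemma fixed_ratio_finite_index:
  assumes "subgroup F Zvec" "finite_index Zvec F"
  shows "fixed_ratio (translation_set F) \<longlonglongrightarrow> 0"
proof (rule tendsto_eventually)
  have "\<forall>\<^sub>F n in sequentially. subgroup_index Zvec F < subgroup_index Zvec (translation_part (\<Gamma>s n))"
    using index_at_top by (simp add: filterlim_at_top flip: Suc_le_eq)
  then show "\<forall>\<^sub>F n in sequentially. fixed_ratio (translation_set F) n = 0"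
  proof eventually_elim
    case (elim n)
    then have "fixed_cosets \<Gamma> (\<Gamma>s n) (translation_set F) = {}"
      using index_le_of_fixed_coset[OF subgroup_\<Gamma>s assms] by (meson not_le)
    then show ?case
      by (simp add: fixed_ratio_def)
  qed
qed

lemma fixed_ratio_translation:
  assumes "v \<noteq> 0"
  shows "fixed_ratio {(mat 1, v)} \<longlonglongrightarrow> 0"
proof (rule ccontr)
  assume not_null: "\<not> fixed_ratio {(mat 1, v)} \<longlonglongrightarrow> 0"
  define \<K> where "\<K> =
    {F. subgroup F Zvec \<and> v \<in> F \<and> \<not> fixed_ratio (translation_set F) \<longlonglongrightarrow> 0}"
  \<comment> \<open>A coset fixed by \<open>v\<close> is fixed by the subgroup that \<open>v\<close>
    generates, so this subgroup witnesses that \<open>\<K>\<close> is nonempty.\<close>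
  have "generate Zvec {v} \<in> \<K>"
  proof -
    have "generate Zvec {v} \<subseteq> {w. (mat 1, w) <#\<^bsub>\<Gamma>\<^esub> c = c} \<longleftrightarrow> (mat 1, v) <#\<^bsub>\<Gamma>\<^esub> c = c"
      if "c \<in> lcosets\<^bsub>\<Gamma>\<^esub> (\<Gamma>s n)" for n c
      using group.generate_subgroup_incl[OF group_Zvec, of "{v}",
          OF _ subgroup_stabilizer_translations[OF subgroup_\<Gamma>s that]]
        generate.incl[of v "{v}" Zvec] by auto
    then have "fixed_cosets \<Gamma> (\<Gamma>s n) (translation_set (generate Zvec {v})) =
        fixed_cosets \<Gamma> (\<Gamma>s n) {(mat 1, v)}" for n
      unfolding fixed_cosets_translations by (auto simp: fixed_cosets_def)
    then have "fixed_ratio (translation_set (generate Zvec {v})) = fixed_ratio {(mat 1, v)}"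
      by (simp add: fixed_ratio_def fun_eq_iff)
    then show ?thesis
      using not_null group.generate_is_subgroup[OF group_Zvec, of "{v}"] generate.incl[of v "{v}" Zvec]
      by (simp add: \<K>_def)
  qed
  then have "\<K> \<noteq> {}" "\<And>K. K \<in> \<K> \<Longrightarrow> subgroup K Zvec"
    by (auto simp: \<K>_def)
  then obtain F where "F \<in> \<K>" and max: "\<And>K. K \<in> \<K> \<Longrightarrow> F \<subseteq> K \<Longrightarrow> K = F"
    using subgroups_Zvec_maximal_element[of \<K>] by blast
  then have F: "subgroup F Zvec" "v \<in> F" "\<not> fixed_ratio (translation_set F) \<longlonglongrightarrow> 0"
    by (auto simp: \<K>_def)
  \<comment> \<open>Every translate of \<open>F\<close> is maximal too: applying the inverse of
    \<open>A\<close> to a non-null \<open>K\<close> above the translate gives a member of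
    \<open>\<K>\<close> above \<open>F\<close>.\<close>
  have max_image: "K = (*v) A ` F"
    if "A \<in> \<Lambda>" "subgroup K Zvec" "(*v) A ` F \<subseteq> K" "\<not> fixed_ratio (translation_set K) \<longlonglongrightarrow> 0" for A K
  proof -
    obtain B where B: "B \<in> \<Lambda>" "A ** B = mat 1" "B ** A = mat 1"
      using SLZ_subgroup_inverse[OF subgroup_\<Lambda> \<open>A \<in> \<Lambda>\<close>] .
    have "(*v) B ` (*v) A ` F \<subseteq> (*v) B ` K"
      using that(3) by blast
    then have "F \<subseteq> (*v) B ` K"
      by (simp add: image_image matrix_vector_mul_assoc B)
    moreover from this F(2) have "(*v) B ` K \<in> \<K>"
      using that(4) subgroup_image_Zvec[OF that(2)] B(1) by (auto simp: \<K>_def fixed_ratio_image)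
    ultimately have "(*v) A ` (*v) B ` K = (*v) A ` F"
      using max by metis
    then show ?thesis
      by (simp add: image_image matrix_vector_mul_assoc B)
  qed
  define \<O> where "\<O> = (\<lambda>A. (*v) A ` F) ` \<Lambda>"
  have sub: "subgroup K Zvec" if "K \<in> \<O>" for K
    using that subgroup_image_Zvec[OF F(1)] by (auto simp: \<O>_def)
  have "finite \<O>"
  proof (rule ccontr)
    assume "infinite \<O>"
    have "(\<lambda>n. real (card (fixed_cosets \<Gamma> (\<Gamma>s n) (translation_set F))) /
        real (card (lcosets\<^bsub>\<Gamma>\<^esub> (\<Gamma>s n)))) \<longlonglongrightarrow> 0"
    proof (rule infinitely_many_almost_disjoint_imp_null[OF \<open>infinite \<O>\<close>,
          where E = "\<lambda>K n. fixed_cosets \<Gamma> (\<Gamma>s n) (translation_set K)"])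
      fix K K' assume K: "K \<in> \<O>" "K' \<in> \<O>" "K \<noteq> K'"
      have "fixed_ratio (translation_set (K + K')) \<longlonglongrightarrow> 0"
      proof (rule ccontr)
        assume "\<not> fixed_ratio (translation_set (K + K')) \<longlonglongrightarrow> 0"
        \<comment> \<open>A non-null sum would, by maximality of both translates, coincide with each
          of them.\<close>
        then have "K + K' = K" "K + K' = K'"
          using K sub max_image subgroup_set_plus subset_set_plus1 subset_set_plus2
          unfolding \<O>_def by (metis (no_types, lifting) imageE)+
        with \<open>K \<noteq> K'\<close> show False by simp
      qed
      then show "(\<lambda>n. real (card (fixed_cosets \<Gamma> (\<Gamma>s n) (translation_set K) \<inter>
          fixed_cosets \<Gamma> (\<Gamma>s n) (translation_set K'))) / real (card (lcosets\<^bsub>\<Gamma>\<^esub> (\<Gamma>s n)))) \<longlonglongrightarrow> 0"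
        using fixed_cosets_set_plus[OF subgroup_\<Gamma>s sub sub] K
        by (simp add: fixed_ratio_def[abs_def])
    qed (auto simp: \<O>_def finite_lcosets \<Gamma>.lcosets_nonempty[OF subgroup_\<Gamma>s]
        card_fixed_cosets_image[OF subgroup_\<Gamma>s] fixed_cosets_subset)
    with F(3) show False
      by (simp add: fixed_ratio_def[abs_def])
  qed
  moreover have "\<O> \<noteq> {}"
    unfolding \<O>_def using one_mem by blast
  \<comment> \<open>A translate contains the nonzero image of \<open>v\<close>, and finite index
    would make its proportion tend to zero, contrary to the choice of \<open>F\<close>.\<close>
  moreover have "K \<noteq> {0} \<and> \<not> finite_index Zvec K" if K: "K \<in> \<O>" for K
  proof -
    obtain A where A: "A \<in> \<Lambda>" "K = (*v) A ` F"
      using K by (auto simp: \<O>_def)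
    have "A *v v \<noteq> 0"
      using SLZ_subgroup_inverse[OF subgroup_\<Lambda> A(1)] \<open>v \<noteq> 0\<close>
      by (metis matrix_vector_mul_assoc matrix_vector_mul_lid matrix_vector_mult_0_right)
    then show ?thesis
      using A F fixed_ratio_finite_index[OF sub[OF K]] fixed_ratio_image by auto
  qed
  moreover have "(*v) A ` \<Union>\<O> \<subseteq> \<Union>\<O>" if "A \<in> \<Lambda>" for A
  proof -
    have "(*v) A ` K \<in> \<O>" if "K \<in> \<O>" for K
    proof -
      obtain B where "B \<in> \<Lambda>" "K = (*v) B ` F"
        using \<open>K \<in> \<O>\<close> by (auto simp: \<O>_def)
      then show ?thesis
        unfolding \<O>_def using subgroup.m_closed[OF subgroup_\<Lambda> \<open>A \<in> \<Lambda>\<close>, of B]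
        by (intro image_eqI[of _ _ "A ** B"]) (simp_all add: image_image matrix_vector_mul_assoc)
    qed
    then show ?thesis by blast
  qed
  ultimately have "\<not> Z_strongly_irreducible \<Lambda>"
    unfolding Z_strongly_irreducible_def not_not using sub
    by (intro exI[of _ \<O>] conjI ballI) simp_all
  with irreducible show False by simp
qed

text \<open>Conjugating \<open>\<gamma> = (A, v)\<close> by multiples of a translation \<open>u\<close> with \<open>A u \<noteq> u\<close> produces elements any
  two of which differ by a nonzero translation.\<close>
lemma fixed_ratio_null:
  assumes "\<gamma> \<in> carrier \<Gamma>" "\<gamma> \<noteq> \<one>\<^bsub>\<Gamma>\<^esub>"
  shows "fixed_ratio {\<gamma>} \<longlonglongrightarrow> 0"
proof -
  obtain A v where \<gamma>: "\<gamma> = (A, v)" "A \<in> \<Lambda>"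
    using assms(1) by auto
  show ?thesis
  proof (cases "A = mat 1")
    case True
    then show ?thesis
      using assms(2) fixed_ratio_translation by (simp add: \<gamma>)
  next
    case False
    then obtain u where u: "A *v u \<noteq> u"
      by (metis matrix_eq matrix_vector_mul_lid)
    define w where "w = A *v u - u"
    have "w \<noteq> 0"
      using u by (simp add: w_def)
    \<comment> \<open>The conjugate of \<gamma> by translation by \<open>int j *s u\<close>.\<close>
    define g where "g j = (A, v - int j *s w)" for j
    have g_carrier: "g j \<in> carrier \<Gamma>" for j
      using \<gamma> by (simp add: g_def)
    have conj: "(mat 1, int j *s u) \<otimes>\<^bsub>\<Gamma>\<^esub> \<gamma> \<otimes>\<^bsub>\<Gamma>\<^esub> inv\<^bsub>\<Gamma>\<^esub> (mat 1, int j *s u) = g j" for j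
    proof -
      have "A *v (- (int j *s u)) = - (int j *s (A *v u))"
        by (simp add: vec_eq_iff matrix_vector_mult_def sum_distrib_left sum_negf mult.left_commute)
      then show ?thesis
        by (simp add: inv_translation g_def \<gamma> w_def vector_sub_rdistrib vector_ssub_ldistrib)
    qed
    have "(\<lambda>n. real (card (fixed_cosets \<Gamma> (\<Gamma>s n) {\<gamma>})) / real (card (lcosets\<^bsub>\<Gamma>\<^esub> (\<Gamma>s n)))) \<longlonglongrightarrow> 0"
    proof (rule infinitely_many_almost_disjoint_imp_null[OF infinite_UNIV_nat,
          where E = "\<lambda>j n. fixed_cosets \<Gamma> (\<Gamma>s n) {g j}"])
      fix i j :: nat assume "i \<noteq> j"
      define t where "t = (int j - int i) *s w"
      have "t \<noteq> 0"
        using \<open>i \<noteq> j\<close> \<open>w \<noteq> 0\<close> by (auto simp: t_def vec_eq_iff)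
      show "(\<lambda>n. real (card (fixed_cosets \<Gamma> (\<Gamma>s n) {g i} \<inter> fixed_cosets \<Gamma> (\<Gamma>s n) {g j})) /
          real (card (lcosets\<^bsub>\<Gamma>\<^esub> (\<Gamma>s n)))) \<longlonglongrightarrow> 0"
      proof (rule fixed_ratio_null_mono[OF fixed_ratio_translation[OF \<open>t \<noteq> 0\<close>]])
        fix n
        \<comment> \<open>Hence a coset fixed by both \<open>g i\<close> and \<open>g j\<close> is
          fixed by the nonzero translation \<open>t\<close>, which fixes few cosets.\<close>
        have "g i = (mat 1, t) \<otimes>\<^bsub>\<Gamma>\<^esub> g j"
          by (simp add: g_def t_def vec_eq_iff algebra_simps)
        then have "g i <#\<^bsub>\<Gamma>\<^esub> c = (mat 1, t) <#\<^bsub>\<Gamma>\<^esub> (g j <#\<^bsub>\<Gamma>\<^esub> c)"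
          if "c \<in> lcosets\<^bsub>\<Gamma>\<^esub> (\<Gamma>s n)" for c
          using \<Gamma>.lcosets_assoc[OF subgroup_\<Gamma>s _ g_carrier that, of "(mat 1, t)"] by simp
        then show "fixed_cosets \<Gamma> (\<Gamma>s n) {g i} \<inter> fixed_cosets \<Gamma> (\<Gamma>s n) {g j} \<subseteq>
            fixed_cosets \<Gamma> (\<Gamma>s n) {(mat 1, t)}"
          by (auto simp: fixed_cosets_def)
      qed
    next
      fix j n
      show "card (fixed_cosets \<Gamma> (\<Gamma>s n) {g j}) = card (fixed_cosets \<Gamma> (\<Gamma>s n) {\<gamma>})"
        using \<Gamma>.card_fixed_cosets_conjugate[OF subgroup_\<Gamma>s, of "(mat 1, int j *s u)" "{\<gamma>}" n]
          assms(1) conj[of j] by simp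
    qed (auto simp: finite_lcosets \<Gamma>.lcosets_nonempty[OF subgroup_\<Gamma>s] fixed_cosets_subset)
    then show ?thesis
      by (simp add: fixed_ratio_def[abs_def])
  qed
qed

end

section \<open>Null sets of the Loeb measure\<close>

locale loeb_space =
  fixes \<uu> :: "nat filter" and X :: "nat \<Rightarrow> 'a set"
  assumes ultrafilter: "nonprincipal_ultrafilter \<uu>"
    and finite_X: "\<And>n. finite (X n)" and nonempty_X: "\<And>n. X n \<noteq> {}"
begin

section \<open>Ultrafilters on the natural numbers\<close>

lemma not_bot: "\<uu> \<noteq> bot"
  using ultrafilter by (simp add: nonprincipal_ultrafilter_def)

lemma eventually_not_iff: "eventually (\<lambda>n. \<not> P n) \<uu> \<longleftrightarrow> \<not> eventually P \<uu>"
proof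
  show "\<not> eventually P \<uu>" if "eventually (\<lambda>n. \<not> P n) \<uu>"
  proof
    assume "eventually P \<uu>"
    with that have "eventually (\<lambda>n. False) \<uu>"
      by eventually_elim simp
    with not_bot show False by simp
  qed
  show "eventually (\<lambda>n. \<not> P n) \<uu>" if "\<not> eventually P \<uu>"
    using ultrafilter that unfolding nonprincipal_ultrafilter_def by blast
qed

text \<open>If the complement of a point \<open>m\<close> were not in the filter, the ultrafilter
  property would put \<open>{m}\<close> in it and make it principal. Consequently ordinary limits
  are also limits along \<open>\<uu>\<close>.\<close>

lemma le_sequentially: "\<uu> \<le> sequentially"
proof -
  have "eventually (\<lambda>n. n \<noteq> m) \<uu>" for m
  proof (rule ccontr)
    assume "\<not> eventually (\<lambda>n. n \<noteq> m) \<uu>"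
    then have m: "eventually (\<lambda>n. n = m) \<uu>"
      by (simp add: eventually_not_iff)
    have "\<uu> = principal {m}"
    proof (rule antisym)
      show "\<uu> \<le> principal {m}"
        using m by (simp add: le_principal)
      show "principal {m} \<le> \<uu>"
      proof (rule filter_leI)
        fix P assume "eventually P \<uu>"
        with m have "eventually (\<lambda>n. P m) \<uu>"
          by eventually_elim simp
        with not_bot show "eventually P (principal {m})"
          by (simp add: eventually_principal)
      qed
    qed
    with ultrafilter show False
      by (simp add: nonprincipal_ultrafilter_def)
  qed
  then have "eventually (\<lambda>n. \<forall>m\<in>{..<N}. n \<noteq> m) \<uu>" for N
    by (intro eventually_ball_finite) auto
  moreover have "(\<forall>m\<in>{..<N}. n \<noteq> m) \<longleftrightarrow> N \<le> n" for n N :: nat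
    by (metis lessThan_iff not_le)
  ultimately show ?thesis
    unfolding le_sequentially by simp
qed

section \<open>Points of the ultraproduct and internal sets\<close>

abbreviation ucls :: "(nat \<Rightarrow> 'a) \<Rightarrow> (nat \<Rightarrow> 'a) set" where
  "ucls x \<equiv> ultra_rel \<uu> X `` {x}"

lemma mem_ucls:
  "y \<in> ucls x \<longleftrightarrow> x \<in> Pi UNIV X \<and> y \<in> Pi UNIV X \<and> eventually (\<lambda>n. x n = y n) \<uu>"
  by (auto simp: ultra_rel_def)

lemma ucls_self: "x \<in> Pi UNIV X \<Longrightarrow> x \<in> ucls x"
  by (simp only: mem_ucls) simp

lemma ultraproductE:
  assumes "\<xi> \<in> ultraproduct \<uu> X"
  obtains x where "x \<in> Pi UNIV X" "\<xi> = ucls x"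
  using assms by (auto simp: ultraproduct_def elim: quotientE)

text \<open>Two representatives of a class agree for \<uu>-almost all \<open>n\<close>, so either of
  them decides membership.\<close>

lemma ucls_in_internal_set:
  assumes x: "x \<in> Pi UNIV X"
  shows "ucls x \<in> internal_set \<uu> X A \<longleftrightarrow> eventually (\<lambda>n. x n \<in> A n) \<uu>"
proof
  assume "ucls x \<in> internal_set \<uu> X A"
  then obtain y where y: "y \<in> Pi UNIV X" "eventually (\<lambda>n. y n \<in> A n) \<uu>" "ucls x = ucls y"
    by (auto simp: internal_set_def)
  with ucls_self[OF x] have "x \<in> ucls y" by simp
  then have "eventually (\<lambda>n. y n = x n) \<uu>"
    by (simp only: mem_ucls)
  with y(2) show "eventually (\<lambda>n. x n \<in> A n) \<uu>"
    by eventually_elim simp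
qed (use x in \<open>auto simp: internal_set_def\<close>)

lemma internal_set_subset: "internal_set \<uu> X A \<subseteq> ultraproduct \<uu> X"
  by (auto simp: internal_set_def ultraproduct_def quotient_def)

lemma internal_set_eqI:
  assumes "S \<subseteq> ultraproduct \<uu> X"
    and "\<And>x. x \<in> Pi UNIV X \<Longrightarrow> ucls x \<in> S \<longleftrightarrow> eventually (\<lambda>n. x n \<in> A n) \<uu>"
  shows "S = internal_set \<uu> X A"
proof (rule Set.set_eqI)
  fix \<xi>
  show "\<xi> \<in> S \<longleftrightarrow> \<xi> \<in> internal_set \<uu> X A"
  proof (cases "\<xi> \<in> ultraproduct \<uu> X")
    case True
    then show ?thesis
      by (elim ultraproductE) (simp add: assms(2) ucls_in_internal_set)
  next
    case False
    then show ?thesis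
      using assms(1) internal_set_subset by blast
  qed
qed

text \<open>Where the inclusion fails, choose a point of \<open>A n\<close> outside
  \<open>B n\<close>. If this happened for almost all \<open>n\<close>, the chosen points would give
  a class in the first internal set but not in the second.\<close>

lemma internal_set_subset_imp:
  assumes "internal_set \<uu> X A \<subseteq> internal_set \<uu> X B" and A: "\<And>n. A n \<subseteq> X n"
  shows "eventually (\<lambda>n. A n \<subseteq> B n) \<uu>"
proof (rule ccontr)
  assume "\<not> eventually (\<lambda>n. A n \<subseteq> B n) \<uu>"
  then have ev: "eventually (\<lambda>n. \<not> A n \<subseteq> B n) \<uu>"
    by (simp add: eventually_not_iff)
  \<comment> \<open>At indices where the inclusion holds, any point of the nonempty
    \<open>X n\<close> completes the sequence.\<close>
  have "\<exists>y. y \<in> X n \<and> (\<not> A n \<subseteq> B n \<longrightarrow> y \<in> A n \<and> y \<notin> B n)" for n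
    using A[of n] nonempty_X[of n] by (cases "A n \<subseteq> B n") auto
  then obtain x where x: "\<And>n. x n \<in> X n"
    "\<And>n. \<not> A n \<subseteq> B n \<Longrightarrow> x n \<in> A n \<and> x n \<notin> B n"
    by metis
  have "eventually (\<lambda>n. x n \<in> A n) \<uu>" "eventually (\<lambda>n. x n \<notin> B n) \<uu>"
    using ev by (eventually_elim, simp add: x(2))+
  moreover have "x \<in> Pi UNIV X"
    using x(1) by auto
  ultimately show False
    using assms(1) ucls_in_internal_set[of x] by (auto simp: eventually_not_iff)
qed

text \<open>Unions and differences are taken coordinatewise; this works because an ultrafilter
  decides every property.\<close>

lemma ring_internal_sets: "ring_of_sets (ultraproduct \<uu> X) (internal_sets \<uu> X)"
proof (rule ring_of_setsI)
  show "internal_sets \<uu> X \<subseteq> Pow (ultraproduct \<uu> X)"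
    using internal_set_subset by (auto simp: internal_sets_def)
  have "{} = internal_set \<uu> X (\<lambda>_. {})"
    by (rule internal_set_eqI) (auto simp: not_bot)
  then show "{} \<in> internal_sets \<uu> X"
    unfolding internal_sets_def by blast
next
  fix S T assume "S \<in> internal_sets \<uu> X" "T \<in> internal_sets \<uu> X"
  then obtain A B where A: "\<And>n. A n \<subseteq> X n" "S = internal_set \<uu> X A"
    and B: "\<And>n. B n \<subseteq> X n" "T = internal_set \<uu> X B"
    unfolding internal_sets_def by blast
  have "eventually (\<lambda>n. x n \<in> A n \<or> x n \<in> B n) \<uu> \<longleftrightarrow>
      eventually (\<lambda>n. x n \<in> A n) \<uu> \<or> eventually (\<lambda>n. x n \<in> B n) \<uu>" for x
    using eventually_not_iff[of "\<lambda>n. x n \<in> A n \<or> x n \<in> B n"]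
    by (auto simp: eventually_conj_iff eventually_not_iff)
  then have "S \<union> T = internal_set \<uu> X (\<lambda>n. A n \<union> B n)"
    unfolding A(2) B(2) using internal_set_subset
    by (intro internal_set_eqI) (auto simp: ucls_in_internal_set)
  moreover have "\<forall>n. A n \<union> B n \<subseteq> X n"
    using A(1) B(1) by blast
  ultimately show "S \<union> T \<in> internal_sets \<uu> X"
    unfolding internal_sets_def by blast
  have "S - T = internal_set \<uu> X (\<lambda>n. A n - B n)"
    unfolding A(2) B(2) using internal_set_subset
    by (intro internal_set_eqI)
      (auto simp: ucls_in_internal_set eventually_conj_iff eventually_not_iff)
  moreover have "\<forall>n. A n - B n \<subseteq> X n"
    using A(1) by blast
  ultimately show "S - T \<in> internal_sets \<uu> X"
    unfolding internal_sets_def by blast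
qed

section \<open>The Loeb premeasure\<close>

definition frequency :: "(nat \<Rightarrow> 'a set) \<Rightarrow> nat \<Rightarrow> ennreal" where
  "frequency A n = ennreal (real (card (A n)) / real (card (X n)))"

lemma frequency_mono: "A n \<subseteq> B n \<Longrightarrow> B n \<subseteq> X n \<Longrightarrow> frequency A n \<le> frequency B n"
  unfolding frequency_def using finite_subset[OF _ finite_X[of n]]
  by (intro ennreal_leI divide_right_mono of_nat_mono card_mono) auto

text \<open>The proportions lie in the compact interval [0,1] and so have a cluster point along
  \<open>\<uu>\<close>; for an ultrafilter a cluster point is a limit.\<close>

lemma frequency_converges:
  assumes "\<And>n. A n \<subseteq> X n"
  obtains r where "(frequency A \<longlongrightarrow> r) \<uu>"
proof -
  let ?f = "\<lambda>n. real (card (A n)) / real (card (X n))"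
  have "?f n \<in> {0..1}" for n
    using card_mono[OF finite_X[of n] assms] by (simp add: divide_le_eq_1 finite_X nonempty_X card_gt_0_iff)
  then have "eventually (\<lambda>x. x \<in> {0..1}) (filtermap ?f \<uu>)"
    by (simp add: eventually_filtermap)
  moreover have "filtermap ?f \<uu> \<noteq> bot"
    by (simp add: filtermap_bot_iff not_bot)
  moreover have "compact {0..1::real}"
    by (rule compact_Icc)
  ultimately obtain r where r: "inf (nhds r) (filtermap ?f \<uu>) \<noteq> bot"
    unfolding compact_filter by blast
  have "(?f \<longlongrightarrow> r) \<uu>"
  proof (rule topological_tendstoI, rule ccontr)
    fix S assume "open S" "r \<in> S" "\<not> eventually (\<lambda>n. ?f n \<in> S) \<uu>"
    then have "eventually (\<lambda>x. x \<notin> S) (filtermap ?f \<uu>)" "eventually (\<lambda>x. x \<in> S) (nhds r)"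
      by (simp_all add: eventually_filtermap eventually_not_iff eventually_nhds_in_open)
    then have "eventually (\<lambda>x. False) (inf (nhds r) (filtermap ?f \<uu>))"
      unfolding eventually_inf by blast
    with r show False by simp
  qed
  then have "(frequency A \<longlongrightarrow> ennreal r) \<uu>"
    unfolding frequency_def by (rule tendsto_ennrealI)
  with that show thesis .
qed

text \<open>The definite description is well defined: sequences representing the same internal set
  agree for \<uu>-almost all \<open>n\<close>, so their proportions have the same limit, and limits
  along \<open>\<uu>\<close> are unique.\<close>

lemma loeb_premeasure_eqI:
  assumes A: "\<And>n. A n \<subseteq> X n" and r: "(frequency A \<longlongrightarrow> r) \<uu>"
  shows "loeb_premeasure \<uu> X (internal_set \<uu> X A) = r"
  unfolding loeb_premeasure_def
proof (rule the_equality)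
  show "\<exists>A'. (\<forall>n. A' n \<subseteq> X n) \<and> internal_set \<uu> X A = internal_set \<uu> X A' \<and>
      ((\<lambda>n. ennreal (real (card (A' n)) / real (card (X n)))) \<longlongrightarrow> r) \<uu>"
    using assms unfolding frequency_def by blast
next
  fix r' assume "\<exists>A'. (\<forall>n. A' n \<subseteq> X n) \<and> internal_set \<uu> X A = internal_set \<uu> X A' \<and>
      ((\<lambda>n. ennreal (real (card (A' n)) / real (card (X n)))) \<longlongrightarrow> r') \<uu>"
  then obtain A' where A': "\<And>n. A' n \<subseteq> X n" "internal_set \<uu> X A = internal_set \<uu> X A'"
    "(frequency A' \<longlongrightarrow> r') \<uu>"
    unfolding frequency_def by blast
  have "eventually (\<lambda>n. A n \<subseteq> A' n) \<uu>" "eventually (\<lambda>n. A' n \<subseteq> A n) \<uu>"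
    using internal_set_subset_imp[of A A'] internal_set_subset_imp[of A' A] A A'(1,2) by simp_all
  then have "eventually (\<lambda>n. frequency A n = frequency A' n) \<uu>"
  proof eventually_elim
    case (elim n)
    then have "A n = A' n" by simp
    then show ?case by (simp add: frequency_def)
  qed
  then have "(frequency A' \<longlongrightarrow> r) \<uu>"
    using r by (simp add: tendsto_cong)
  with A'(3) show "r' = r"
    using tendsto_unique not_bot by blast
qed

lemma internal_setsE:
  assumes "S \<in> internal_sets \<uu> X"
  obtains A r where "\<forall>n. A n \<subseteq> X n" "S = internal_set \<uu> X A" "(frequency A \<longlongrightarrow> r) \<uu>"
    "loeb_premeasure \<uu> X S = r"
proof -
  obtain A where A: "\<And>n. A n \<subseteq> X n" "S = internal_set \<uu> X A"
    using assms unfolding internal_sets_def by blast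
  obtain r where "(frequency A \<longlongrightarrow> r) \<uu>"
    using frequency_converges[OF A(1)] .
  with that A loeb_premeasure_eqI[OF A(1)] show thesis by blast
qed

lemma positive_loeb_premeasure: "positive (internal_sets \<uu> X) (loeb_premeasure \<uu> X)"
proof -
  have "{} = internal_set \<uu> X (\<lambda>_. {})"
    by (rule internal_set_eqI) (auto simp: not_bot)
  moreover have "loeb_premeasure \<uu> X (internal_set \<uu> X (\<lambda>_. {})) = 0"
    by (rule loeb_premeasure_eqI) (simp_all add: frequency_def[abs_def])
  ultimately show ?thesis
    by (simp add: positive_def)
qed

lemma increasing_loeb_premeasure: "increasing (internal_sets \<uu> X) (loeb_premeasure \<uu> X)"
  unfolding increasing_def
proof (intro ballI impI)
  fix S T assume "S \<in> internal_sets \<uu> X" "T \<in> internal_sets \<uu> X" "S \<subseteq> T"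
  obtain A r where A: "\<forall>n. A n \<subseteq> X n" "S = internal_set \<uu> X A" "(frequency A \<longlongrightarrow> r) \<uu>"
    "loeb_premeasure \<uu> X S = r"
    using internal_setsE[OF \<open>S \<in> internal_sets \<uu> X\<close>] .
  obtain B s where B: "\<forall>n. B n \<subseteq> X n" "T = internal_set \<uu> X B" "(frequency B \<longlongrightarrow> s) \<uu>"
    "loeb_premeasure \<uu> X T = s"
    using internal_setsE[OF \<open>T \<in> internal_sets \<uu> X\<close>] .
  have "eventually (\<lambda>n. A n \<subseteq> B n) \<uu>"
    using internal_set_subset_imp[of A B] A B \<open>S \<subseteq> T\<close> by blast
  then have "eventually (\<lambda>n. frequency A n \<le> frequency B n) \<uu>"
    by eventually_elim (simp add: frequency_mono B(1))
  then show "loeb_premeasure \<uu> X S \<le> loeb_premeasure \<uu> X T"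
    unfolding A(4) B(4) by (rule tendsto_le[OF not_bot B(3) A(3)])
qed

section \<open>The Caratheodory measure and its null sets\<close>

abbreviation loeb_outer :: "(nat \<Rightarrow> 'a) set set \<Rightarrow> ennreal" where
  "loeb_outer \<equiv> outer_measure (internal_sets \<uu> X) (loeb_premeasure \<uu> X)"

lemma outer_measure_space_loeb_outer:
  "outer_measure_space (Pow (ultraproduct \<uu> X)) loeb_outer"
  by (rule ring_of_sets.outer_measure_space_outer_measure[OF ring_internal_sets
        positive_loeb_premeasure increasing_loeb_premeasure])

lemma measure_space_loeb:
  "measure_space (ultraproduct \<uu> X)
     (lambda_system (ultraproduct \<uu> X) (Pow (ultraproduct \<uu> X)) loeb_outer) loeb_outer"
  by (rule sigma_algebra.caratheodory_lemma[OF sigma_algebra_Pow outer_measure_space_loeb_outer])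

text \<open>\<open>measure_of\<close> passes to the generated sigma-algebra and keeps the given
  function only if it is a measure there. Caratheodory's lemma provides both, so the Loeb space has
  the intended sets and values.\<close>

lemma
  shows space_loeb: "space (loeb_measure \<uu> X) = ultraproduct \<uu> X"
    and sets_loeb: "sets (loeb_measure \<uu> X) =
      lambda_system (ultraproduct \<uu> X) (Pow (ultraproduct \<uu> X)) loeb_outer"
    and emeasure_loeb: "S \<in> sets (loeb_measure \<uu> X) \<Longrightarrow> emeasure (loeb_measure \<uu> X) S = loeb_outer S"
proof -
  let ?L = "lambda_system (ultraproduct \<uu> X) (Pow (ultraproduct \<uu> X)) loeb_outer"
  have alg: "sigma_algebra (ultraproduct \<uu> X) ?L" and "positive ?L loeb_outer"
    "countably_additive ?L loeb_outer"
    using measure_space_loeb by (auto simp: measure_space_def)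
  have L: "?L \<subseteq> Pow (ultraproduct \<uu> X)"
    using lambda_system_sets by blast
  show "space (loeb_measure \<uu> X) = ultraproduct \<uu> X"
    using L by (simp add: loeb_measure_def Let_def space_measure_of)
  show sets: "sets (loeb_measure \<uu> X) = ?L"
    by (simp add: loeb_measure_def Let_def sets_measure_of[OF L] sigma_algebra.sigma_sets_eq[OF alg])
  show "emeasure (loeb_measure \<uu> X) S = loeb_outer S" if "S \<in> sets (loeb_measure \<uu> X)"
    using that \<open>positive ?L loeb_outer\<close> \<open>countably_additive ?L loeb_outer\<close> alg
    unfolding sets by (simp add: loeb_measure_def Let_def emeasure_measure_of_sigma)
qed

text \<open>This is completeness: for a set of outer measure zero the splitting condition for any
  \<open>T\<close> follows from monotonicity and subadditivity.\<close>

lemma null_sets_loebI: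
  assumes S: "S \<subseteq> ultraproduct \<uu> X" and "loeb_outer S = 0"
  shows "S \<in> null_sets (loeb_measure \<uu> X)"
proof -
  let ?\<Omega> = "ultraproduct \<uu> X"
  have pos: "positive (Pow ?\<Omega>) loeb_outer" and inc: "increasing (Pow ?\<Omega>) loeb_outer"
    and sub: "countably_subadditive (Pow ?\<Omega>) loeb_outer"
    using outer_measure_space_loeb_outer by (auto simp: outer_measure_space_def)
  have "loeb_outer (S \<inter> T) + loeb_outer ((?\<Omega> - S) \<inter> T) = loeb_outer T" if "T \<in> Pow ?\<Omega>" for T
  proof -
    have *: "loeb_outer (S \<inter> T) = 0"
      using increasingD[OF inc, of "S \<inter> T" S] S assms(2) by auto
    have "loeb_outer ((?\<Omega> - S) \<inter> T) \<le> loeb_outer T"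
      using that by (intro increasingD[OF inc]) auto
    moreover have "loeb_outer ((S \<inter> T) \<union> ((?\<Omega> - S) \<inter> T)) \<le>
        loeb_outer (S \<inter> T) + loeb_outer ((?\<Omega> - S) \<inter> T)"
      using that
      by (intro subadditiveD[OF ring_of_sets.countably_subadditive_subadditive[OF ring_of_sets_Pow pos sub]])
        auto
    moreover have "(S \<inter> T) \<union> ((?\<Omega> - S) \<inter> T) = T"
      using that by auto
    ultimately show ?thesis
      by (simp add: *)
  qed
  then have "S \<in> sets (loeb_measure \<uu> X)"
    using S by (simp add: sets_loeb lambda_system_def)
  then show ?thesis
    by (simp add: emeasure_loeb assms(2) null_sets_def)
qed

lemma internal_set_null:
  assumes A: "\<And>n. A n \<subseteq> X n" and "(\<lambda>n. real (card (A n)) / real (card (X n))) \<longlonglongrightarrow> 0"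
  shows "internal_set \<uu> X A \<in> null_sets (loeb_measure \<uu> X)"
proof (rule null_sets_loebI[OF internal_set_subset])
  interpret ring_of_sets "ultraproduct \<uu> X" "internal_sets \<uu> X"
    by (rule ring_internal_sets)
  have "((\<lambda>n. real (card (A n)) / real (card (X n))) \<longlongrightarrow> 0) \<uu>"
    using assms(2) le_sequentially by (rule filterlim_mono[OF _ order_refl])
  then have "(frequency A \<longlongrightarrow> 0) \<uu>"
    unfolding frequency_def using tendsto_ennrealI by fastforce
  then have zero: "loeb_premeasure \<uu> X (internal_set \<uu> X A) = 0"
    by (rule loeb_premeasure_eqI[OF A])
  \<comment> \<open>The internal set covers itself; empty sets pad the cover to a sequence.\<close>
  let ?A = "\<lambda>i::nat. if i = 0 then internal_set \<uu> X A else {}"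
  have "internal_set \<uu> X A \<in> internal_sets \<uu> X"
    using A by (auto simp: internal_sets_def)
  then have "loeb_outer (internal_set \<uu> X A) \<le> (\<Sum>i. loeb_premeasure \<uu> X (?A i))"
    by (intro outer_measure_le[OF positive_loeb_premeasure increasing_loeb_premeasure]) auto
  also have "\<dots> = 0"
    using zero positiveD1[OF positive_loeb_premeasure] by (simp add: if_distrib cong: if_cong)
  finally show "loeb_outer (internal_set \<uu> X A) = 0" by simp
qed

end

text \<open>The points of the ultraproduct fixed by \<open>g\<close> lie in the internal set of
  coordinatewise fixed cosets, which is null. Countability of the group moves the quantifier over
  \<open>g\<close> inside the almost everywhere statement.\<close>

lemma (in group) sofic_approximationI:
  assumes "countable (carrier G)"
    and H: "\<And>n. subgroup (H n) G" and fin: "\<And>n. finite_index G (H n)"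
    and null: "\<And>g. g \<in> carrier G \<Longrightarrow> g \<noteq> \<one> \<Longrightarrow>
      (\<lambda>n. real (card (fixed_cosets G (H n) {g})) / real (card (lcosets (H n)))) \<longlonglongrightarrow> 0"
  shows "sofic_approximation G H"
  unfolding sofic_approximation_def
proof (intro allI impI)
  fix \<uu> assume "nonprincipal_ultrafilter \<uu>"
  define X where "X = (\<lambda>n. lcosets\<^bsub>G\<^esub> (H n))"
  interpret loeb_space \<uu> X
    using \<open>nonprincipal_ultrafilter \<uu>\<close> lcosets_nonempty[OF H] fin
    by unfold_locales (auto simp: X_def finite_index_def)
  have "AE \<xi> in loeb_measure \<uu> X. ultra_coset_action G \<uu> H g \<xi> \<noteq> \<xi>"
    if g: "g \<in> carrier G - {\<one>\<^bsub>G\<^esub>}" for g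
  proof (rule AE_I')
    define A where "A = (\<lambda>n. fixed_cosets G (H n) {g})"
    show "internal_set \<uu> X A \<in> null_sets (loeb_measure \<uu> X)"
    proof (rule internal_set_null)
      show "(\<lambda>n. real (card (A n)) / real (card (X n))) \<longlonglongrightarrow> 0"
        using null[of g] g by (simp add: A_def X_def)
    qed (auto simp: A_def X_def fixed_cosets_def)
    show "{\<xi> \<in> space (loeb_measure \<uu> X). \<not> ultra_coset_action G \<uu> H g \<xi> \<noteq> \<xi>} \<subseteq> internal_set \<uu> X A"
    proof clarsimp
      fix \<xi> assume "\<xi> \<in> space (loeb_measure \<uu> X)" and fixed: "ultra_coset_action G \<uu> H g \<xi> = \<xi>"
      then obtain x where x: "x \<in> Pi UNIV X" "\<xi> = ucls x"
        using ultraproductE space_loeb by metis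
      define y where "y = (\<lambda>n. g <#\<^bsub>G\<^esub> x n)"
      have "y \<in> Pi UNIV X"
        using x(1) lcosets_translate[OF H] g by (auto simp: y_def X_def Pi_iff)
      then have "y \<in> ucls y" "x \<in> \<xi>"
        using x ucls_self by simp_all
      \<comment> \<open>The action is a union over representatives, so the contribution of
        \<open>x\<close> already contains \<open>y\<close>; as the class is fixed, \<open>y\<close>
        represents the class of \<open>x\<close>.\<close>
      then have "y \<in> ultra_coset_action G \<uu> H g \<xi>"
        unfolding ultra_coset_action_def X_def y_def by blast
      then have "eventually (\<lambda>n. x n = y n) \<uu>"
        unfolding fixed unfolding x(2) mem_ucls by blast
      then have "eventually (\<lambda>n. x n \<in> A n) \<uu>"
        using x(1) by (auto simp: A_def X_def y_def fixed_cosets_def Pi_iff elim!: eventually_mono)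
      then show "\<xi> \<in> internal_set \<uu> X A"
        by (simp add: x ucls_in_internal_set)
    qed
  qed
  moreover have "countable (carrier G - {\<one>\<^bsub>G\<^esub>})"
    using assms(1) by auto
  ultimately show "AE \<xi> in loeb_measure \<uu> (\<lambda>n. lcosets\<^bsub>G\<^esub> (H n)).
      \<forall>g\<in>carrier G - {\<one>\<^bsub>G\<^esub>}. ultra_coset_action G \<uu> H g \<xi> \<noteq> \<xi>"
    unfolding X_def[symmetric] by (subst AE_ball_countable) auto
qed

section \<open>The rank of finite index subgroups\<close>

text \<open>These are the Schreier generators. The crude count suffices, since the index of the linear part
  cancels in the rank gradient and the index of the translation part tends to infinity.\<close>
lemma (in group) finite_index_subgroup_generators:
  assumes S: "finite S" "S \<subseteq> carrier G" "generate G S = carrier G"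
    and H: "subgroup H G" and fin: "finite (lcosets H)"
  obtains T where "finite T" "card T \<le> card (lcosets H) * card S" "T \<subseteq> H" "generate G T = H"
proof -
  \<comment> \<open>The trivial coset gets the representative \<open>\<one>\<close>, so that later
    \<open>R h = \<one>\<close> for \<open>h\<close> in \<open>H\<close>.\<close>
  have "\<exists>a. a \<in> carrier G \<and> a <# H = c \<and> (c = H \<longrightarrow> a = \<one>)" if c: "c \<in> lcosets H" for c
  proof (cases "c = H")
    case True
    then show ?thesis
      using lcos_mult_one[OF subgroup.subset[OF H]] by auto
  next
    case False
    then show ?thesis
      using lcosetsE[OF c] by blast
  qed
  then obtain r where r: "\<And>c. c \<in> lcosets H \<Longrightarrow> r c \<in> carrier G \<and> r c <# H = c"
    and r_H: "H \<in> lcosets H \<Longrightarrow> r H = \<one>"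
    by metis
  have H_coset: "h <# H = H" if "h \<in> H" for h
    using l_coset_eq_iff[OF H one_closed, of h] that subgroup.mem_carrier[OF H that]
      lcos_mult_one[OF subgroup.subset[OF H]] by simp
  then have "r H = \<one>"
    using r_H l_coset_in_lcosets[OF one_closed, of H] subgroup.one_closed[OF H] by simp
  define R where "R x = r (x <# H)" for x
  have R [simp]: "R x \<in> carrier G" and R_coset: "R x <# H = x <# H" if "x \<in> carrier G" for x
    using r[OF l_coset_in_lcosets[OF that]] by (simp_all add: R_def)
  have R_cong: "R x = R y" if "x <# H = y <# H" for x y
    using that by (simp add: R_def)
  have translate_cong: "(g \<otimes> x) <# H = (g \<otimes> y) <# H"
    if "x <# H = y <# H" "g \<in> carrier G" "x \<in> carrier G" "y \<in> carrier G" for g x y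
    using that lcos_m_assoc[OF subgroup.subset[OF H], of g] by metis
  define T where "T = (\<lambda>(c, s). inv (R (s \<otimes> r c)) \<otimes> (s \<otimes> r c)) ` ((lcosets H) \<times> S)"
  define K where "K = generate G T"
  have "T \<subseteq> H"
  proof
    fix t assume "t \<in> T"
    then obtain c s where cs: "c \<in> lcosets H" "s \<in> S" "t = inv (R (s \<otimes> r c)) \<otimes> (s \<otimes> r c)"
      by (auto simp: T_def)
    then have "s \<otimes> r c \<in> carrier G"
      using r S(2) by auto
    then show "t \<in> H"
      using l_coset_eq_iff[OF H R, of "s \<otimes> r c"] R_coset cs(3) by blast
  qed
  then have "T \<subseteq> carrier G"
    using subgroup.subset[OF H] by blast
  then have K: "subgroup K G"
    unfolding K_def by (rule generate_is_subgroup)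
  have "K \<subseteq> H"
    unfolding K_def by (rule generate_subgroup_incl[OF \<open>T \<subseteq> H\<close> H])
  \<comment> \<open>The Schreier generator of \<open>s\<close> and the coset of \<open>x\<close>;
    under the outer \<open>R\<close>, \<open>x\<close> may replace \<open>R x\<close> because both
    give the same coset.\<close>
  have step: "inv (R (s \<otimes> x)) \<otimes> (s \<otimes> R x) \<in> K" if "s \<in> S" "x \<in> carrier G" for s x
  proof -
    have s: "s \<in> carrier G"
      using S(2) that by blast
    have "x <# H \<in> lcosets H"
      by (rule l_coset_in_lcosets[OF that(2)])
    then have "inv (R (s \<otimes> R x)) \<otimes> (s \<otimes> R x) \<in> T"
      using \<open>s \<in> S\<close> by (force simp: T_def R_def[of x])
    moreover have "R (s \<otimes> R x) = R (s \<otimes> x)"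
      using that s by (intro R_cong translate_cong R_coset) auto
    ultimately show ?thesis
      unfolding K_def by (metis generate.incl)
  qed
  \<comment> \<open>The invariant is preserved when \<open>x\<close> is multiplied on the left by a
    generator or its inverse, hence by any \<open>g\<close>. Starting from \<open>\<one>\<close> it
    reaches the whole group, and on \<open>H\<close>, where \<open>R\<close> is trivial, it says
    that \<open>H\<close> lies in \<open>K\<close>.\<close>
  have propagate: "\<forall>x\<in>carrier G. inv (R x) \<otimes> x \<in> K \<longrightarrow> inv (R (g \<otimes> x)) \<otimes> (g \<otimes> x) \<in> K"
    if "g \<in> generate G S" for g
    using that
  proof (induction g rule: generate.induct)
    case (incl s)
    show ?case
    proof (intro ballI impI)
      fix x assume x: "x \<in> carrier G" "inv (R x) \<otimes> x \<in> K"
      have s: "s \<in> carrier G"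
        using S(2) incl by blast
      have "(inv (R (s \<otimes> x)) \<otimes> (s \<otimes> R x)) \<otimes> (inv (R x) \<otimes> x) \<in> K"
        by (rule subgroup.m_closed[OF K step[OF incl x(1)] x(2)])
      also have "(inv (R (s \<otimes> x)) \<otimes> (s \<otimes> R x)) \<otimes> (inv (R x) \<otimes> x) =
          inv (R (s \<otimes> x)) \<otimes> (s \<otimes> (R x \<otimes> (inv (R x) \<otimes> x)))"
        using s x(1) by (simp add: m_assoc)
      also have "R x \<otimes> (inv (R x) \<otimes> x) = x"
        using x(1) by (simp flip: m_assoc)
      finally show "inv (R (s \<otimes> x)) \<otimes> (s \<otimes> x) \<in> K" .
    qed
  next
    case (inv s)
    show ?case
    proof (intro ballI impI)
      fix x assume x: "x \<in> carrier G" "inv (R x) \<otimes> x \<in> K"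
      have s: "s \<in> carrier G"
        using S(2) inv by blast
      define y where "y = inv s \<otimes> x"
      have y: "y \<in> carrier G" and sy: "s \<otimes> y = x"
        using s x(1) by (simp_all add: y_def flip: m_assoc)
      \<comment> \<open>Since \<open>s \<otimes> y = x\<close>, the Schreier generator of
        \<open>s\<close> at \<open>y\<close> is the one to invert.\<close>
      have "inv (inv (R x) \<otimes> (s \<otimes> R y)) \<otimes> (inv (R x) \<otimes> x) \<in> K"
        using step[OF inv y] x(2) subgroup.m_closed[OF K] subgroup.m_inv_closed[OF K]
        by (simp add: sy)
      also have "inv (inv (R x) \<otimes> (s \<otimes> R y)) \<otimes> (inv (R x) \<otimes> x) =
          inv (R y) \<otimes> (inv s \<otimes> (R x \<otimes> (inv (R x) \<otimes> x)))"
        using s x(1) y by (simp add: inv_mult_group m_assoc)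
      also have "R x \<otimes> (inv (R x) \<otimes> x) = x"
        using x(1) by (simp flip: m_assoc)
      finally show "inv (R (inv s \<otimes> x)) \<otimes> (inv s \<otimes> x) \<in> K"
        by (simp add: y_def)
    qed
  next
    case (eng g h)
    then show ?case
      using S by (simp add: m_assoc generate_in_carrier[OF S(2)])
  qed simp
  have "R \<one> = \<one>"
    using \<open>r H = \<one>\<close> H_coset[OF subgroup.one_closed[OF H]] by (simp add: R_def)
  then have closed: "inv (R g) \<otimes> g \<in> K" if "g \<in> carrier G" for g
    using bspec[OF propagate[of g] one_closed] that S(3) subgroup.one_closed[OF K] by simp
  have "H \<subseteq> K"
  proof
    fix h assume "h \<in> H"
    then have "h \<in> carrier G" "R h = \<one>"
      using subgroup.mem_carrier[OF H] H_coset \<open>r H = \<one>\<close> by (auto simp: R_def)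
    then show "h \<in> K"
      using closed[of h] by simp
  qed
  show thesis
  proof (rule that)
    show "finite T"
      unfolding T_def using fin S(1) by auto
    have "card T \<le> card ((lcosets H) \<times> S)"
      unfolding T_def by (rule card_image_le) (use fin S(1) in auto)
    then show "card T \<le> card (lcosets H) * card S"
      by (simp add: card_cartesian_product)
    show "T \<subseteq> H" by fact
    show "generate G T = H"
      using \<open>H \<subseteq> K\<close> \<open>K \<subseteq> H\<close> by (simp add: K_def)
  qed
qed

lemma group_rank_le:
  "finite S \<Longrightarrow> S \<subseteq> H \<Longrightarrow> generate G S = H \<Longrightarrow> group_rank G H \<le> enat (card S)"
  unfolding group_rank_def by (intro Inf_lower) blast

lemma group_rank_finiteE:
  assumes "group_rank G H < \<infinity>"
  obtains S where "finite S" "S \<subseteq> H" "generate G S = H"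
proof -
  have "{enat (card S) | S. finite S \<and> S \<subseteq> H \<and> generate G S = H} \<noteq> {}"
  proof
    assume "{enat (card S) | S. finite S \<and> S \<subseteq> H \<and> generate G S = H} = {}"
    then have "group_rank G H = \<infinity>"
      unfolding group_rank_def by (simp only: Inf_empty top_enat_def)
    with assms show False by simp
  qed
  with that show thesis by blast
qed

section \<open>Linear and translation parts of a subgroup\<close>

context integral_affine_group
begin

text \<open>\<Lambda> as a group of its own, so that the Schreier bound, which starts from
  generators of an entire group, applies to its subgroups.\<close>

definition linear_group :: "(int ^ 'n ^ 'n) monoid" where
  "linear_group = SLZ\<lparr>carrier := \<Lambda>\<rparr>"

lemma linear_group_simps [simp]:
  "carrier linear_group = \<Lambda>" "A \<otimes>\<^bsub>linear_group\<^esub> B = A ** B" "\<one>\<^bsub>linear_group\<^esub> = mat 1"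
  by (simp_all add: linear_group_def SLZ_def)

sublocale linear: group linear_group
  unfolding linear_group_def by (rule group.subgroup_imp_group[OF group_SLZ subgroup_\<Lambda>])

lemma inverseE:
  assumes "A \<in> \<Lambda>"
  obtains B where "B \<in> \<Lambda>" "A ** B = mat 1" "B ** A = mat 1"
    "inv\<^bsub>linear_group\<^esub> A = B" "\<forall>v. inv\<^bsub>\<Gamma>\<^esub> (A, v) = (B, - (B *v v))"
proof -
  obtain B where B: "B \<in> \<Lambda>" "A ** B = mat 1" "B ** A = mat 1"
    using SLZ_subgroup_inverse[OF subgroup_\<Lambda> assms] .
  moreover have "inv\<^bsub>linear_group\<^esub> A = B"
    using assms B by (intro linear.inv_equality) auto
  ultimately show thesis
    using that[of B] inv_semidirect_Zvec[OF subgroup_\<Lambda> assms] by (simp add: \<Gamma>_def)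
qed

lemma subgroup_linear_part:
  assumes H: "subgroup H \<Gamma>"
  shows "subgroup (fst ` H) linear_group"
proof (rule subgroup.intro)
  have sub: "H \<subseteq> \<Lambda> \<times> UNIV"
    using subgroup.subset[OF H] by simp
  then show "fst ` H \<subseteq> carrier linear_group"
    by auto
  show "\<one>\<^bsub>linear_group\<^esub> \<in> fst ` H"
    using subgroup.one_closed[OF H] by force
  show "A \<otimes>\<^bsub>linear_group\<^esub> B \<in> fst ` H" if AB: "A \<in> fst ` H" "B \<in> fst ` H" for A B
  proof -
    obtain v w where "(A, v) \<in> H" "(B, w) \<in> H"
      using AB by auto
    then show ?thesis
      using subgroup.m_closed[OF H, of "(A, v)" "(B, w)"] by force
  qed
  show "inv\<^bsub>linear_group\<^esub> A \<in> fst ` H" if A: "A \<in> fst ` H" for A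
  proof -
    obtain v where v: "(A, v) \<in> H"
      using A by auto
    then have "A \<in> \<Lambda>"
      using sub by auto
    then obtain B where B: "inv\<^bsub>linear_group\<^esub> A = B" "\<forall>v. inv\<^bsub>\<Gamma>\<^esub> (A, v) = (B, - (B *v v))"
      by (rule inverseE) blast
    then have "(B, - (B *v v)) \<in> H"
      using subgroup.m_inv_closed[OF H v] by simp
    then show ?thesis
      unfolding B(1) by force
  qed
qed

lemma translation_part_subgroup: "subgroup H \<Gamma> \<Longrightarrow> subgroup (translation_part H) Zvec"
  using subgroup_translation_part[OF subgroup_\<Lambda>] by (simp add: \<Gamma>_def)

text \<open>A pair of cosets is sent to the coset of a product of representatives, from which first
  the linear and then the translation coset can be recovered. This bounds the index of
  \<open>H\<close> below by the product of the two indices.\<close>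

lemma lcosets_product_embedding:
  assumes H: "subgroup H \<Gamma>"
  obtains f where
    "inj_on f ((lcosets\<^bsub>linear_group\<^esub> (fst ` H)) \<times> (lcosets\<^bsub>Zvec\<^esub> (translation_part H)))"
    "f ` ((lcosets\<^bsub>linear_group\<^esub> (fst ` H)) \<times> (lcosets\<^bsub>Zvec\<^esub> (translation_part H))) \<subseteq> lcosets\<^bsub>\<Gamma>\<^esub> H"
proof -
  let ?C = "lcosets\<^bsub>linear_group\<^esub> (fst ` H)" and ?D = "lcosets\<^bsub>Zvec\<^esub> (translation_part H)"
  have "\<exists>B. B \<in> \<Lambda> \<and> C = B <#\<^bsub>linear_group\<^esub> fst ` H" if "C \<in> ?C" for C
    using that by (auto simp: LCOSETS_def)
  then obtain b where b: "\<And>C. C \<in> ?C \<Longrightarrow> b C \<in> \<Lambda> \<and> C = b C <#\<^bsub>linear_group\<^esub> fst ` H"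
    by metis
  have "\<exists>v. D = v <#\<^bsub>Zvec\<^esub> translation_part H" if "D \<in> ?D" for D
    using that by (auto simp: lcosets_Zvec)
  then obtain w where w: "\<And>D. D \<in> ?D \<Longrightarrow> D = w D <#\<^bsub>Zvec\<^esub> translation_part H"
    by metis
  \<comment> \<open>The representative is \<open>(b C, 0)\<close> times \<open>(mat 1, w D)\<close>.
    The twist by \<open>b C\<close> makes the quotient of two such elements with
    \<open>C = C'\<close> the translation by \<open>w D' - w D\<close>.\<close>
  define f where "f = (\<lambda>(C, D). (b C, b C *v w D) <#\<^bsub>\<Gamma>\<^esub> H)"
  have "C = C' \<and> D = D'"
    if "C \<in> ?C" "C' \<in> ?C" "D \<in> ?D" "D' \<in> ?D" and eq: "f (C, D) = f (C', D')" for C C' D D'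
  proof -
    have bC: "b C \<in> \<Lambda>" "b C' \<in> \<Lambda>"
      using b that by auto
    obtain B where B: "B \<in> \<Lambda>" "b C ** B = mat 1" "B ** b C = mat 1"
      "inv\<^bsub>linear_group\<^esub> (b C) = B" "\<forall>v. inv\<^bsub>\<Gamma>\<^esub> (b C, v) = (B, - (B *v v))"
      using inverseE[OF bC(1)] .
    have "inv\<^bsub>\<Gamma>\<^esub> (b C, b C *v w D) \<otimes>\<^bsub>\<Gamma>\<^esub> (b C', b C' *v w D') \<in> H"
      using eq bC \<Gamma>.l_coset_eq_iff[OF H, of "(b C, b C *v w D)" "(b C', b C' *v w D')"]
      by (simp add: f_def)
    then have mem: "(B ** b C', (B ** b C') *v w D' - w D) \<in> H"
      using B by (simp add: matrix_vector_mul_assoc)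
    then have "B ** b C' \<in> fst ` H"
      by force
    then have "b C <#\<^bsub>linear_group\<^esub> fst ` H = b C' <#\<^bsub>linear_group\<^esub> fst ` H"
      using linear.l_coset_eq_iff[OF subgroup_linear_part[OF H], of "b C" "b C'"] bC B(4) by simp
    then have "C = C'"
      using b that by metis
    then have "w D' - w D \<in> translation_part H"
      using mem B(3) by (simp add: translation_part_def)
    then have "w D <#\<^bsub>Zvec\<^esub> translation_part H = w D' <#\<^bsub>Zvec\<^esub> translation_part H"
      using group.l_coset_eq_iff[OF group_Zvec translation_part_subgroup[OF H], of "w D" "w D'"]
      by (simp add: algebra_simps)
    then have "D = D'"
      using w that by metis
    with \<open>C = C'\<close> show ?thesis by simp
  qed
  then have "inj_on f (?C \<times> ?D)"
    by (intro inj_onI) auto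
  moreover have "f ` (?C \<times> ?D) \<subseteq> lcosets\<^bsub>\<Gamma>\<^esub> H"
    using b \<Gamma>.l_coset_in_lcosets by (auto simp: f_def)
  ultimately show thesis
    using that by blast
qed

lemma
  assumes H: "subgroup H \<Gamma>" and fin: "finite_index \<Gamma> H"
  shows finite_index_linear_part: "finite (lcosets\<^bsub>linear_group\<^esub> (fst ` H))"
    and index_translation_part_pos: "0 < subgroup_index Zvec (translation_part H)"
    and index_product_le: "card (lcosets\<^bsub>linear_group\<^esub> (fst ` H)) *
      subgroup_index Zvec (translation_part H) \<le> subgroup_index \<Gamma> H"
proof -
  let ?C = "lcosets\<^bsub>linear_group\<^esub> (fst ` H)" and ?D = "lcosets\<^bsub>Zvec\<^esub> (translation_part H)"
  obtain f where f: "inj_on f (?C \<times> ?D)" "f ` (?C \<times> ?D) \<subseteq> lcosets\<^bsub>\<Gamma>\<^esub> H"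
    using lcosets_product_embedding[OF H] .
  have nonempty: "?C \<noteq> {}" "?D \<noteq> {}"
    using linear.lcosets_nonempty[OF subgroup_linear_part[OF H]] by (auto simp: lcosets_Zvec)
  have fin_prod: "finite (?C \<times> ?D)"
    using inj_on_finite[OF f] fin by (simp add: finite_index_def)
  with nonempty have "finite ?C" "finite ?D"
    by (simp_all add: finite_cartesian_product_iff)
  then show "finite ?C"
    by simp
  show "0 < subgroup_index Zvec (translation_part H)"
    using nonempty \<open>finite ?D\<close> by (simp add: subgroup_index_def card_gt_0_iff)
  show "card ?C * subgroup_index Zvec (translation_part H) \<le> subgroup_index \<Gamma> H"
    using card_inj_on_le[OF f] fin
    by (simp add: subgroup_index_def finite_index_def card_cartesian_product)
qed

text \<open>Lifts of \<open>T\<close> reach every linear part of \<open>H\<close>. Dividing an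
  element of \<open>H\<close> by a generated element with the same linear part leaves a translation
  in \<open>H\<close>, and these are generated by at most d translations.\<close>

lemma group_rank_le_extension:
  assumes H: "subgroup H \<Gamma>" and T: "finite T" "T \<subseteq> fst ` H" "generate linear_group T = fst ` H"
  shows "group_rank \<Gamma> H \<le> enat (card T + CARD('n))"
proof -
  obtain V where V: "finite V" "card V \<le> CARD('n)" "V \<subseteq> translation_part H"
    "generate Zvec V = translation_part H"
    using subgroup_Zvec_finitely_generated[OF translation_part_subgroup[OF H]] .
  have "\<exists>v. (A, v) \<in> H" if "A \<in> T" for A
    using subsetD[OF T(2) that] by auto
  then obtain l where l: "\<And>A. A \<in> T \<Longrightarrow> (A, l A) \<in> H"
    by metis
  define U where "U = (\<lambda>A. (A, l A)) ` T \<union> translation_set V"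
  define K where "K = generate \<Gamma> U"
  have "U \<subseteq> H"
    using l V(3) by (auto simp: U_def translation_part_def)
  then have "U \<subseteq> carrier \<Gamma>"
    using subgroup.subset[OF H] by blast
  then have K: "subgroup K \<Gamma>"
    unfolding K_def by (rule \<Gamma>.generate_is_subgroup)
  have "K \<subseteq> H"
    unfolding K_def by (rule \<Gamma>.generate_subgroup_incl[OF \<open>U \<subseteq> H\<close> H])
  have "U \<subseteq> K"
    unfolding K_def by (auto intro: generate.incl)
  then have "T \<subseteq> fst ` K" "V \<subseteq> translation_part K"
    by (force simp: U_def translation_part_def)+
  have linear: "fst ` H \<subseteq> fst ` K"
    using linear.generate_subgroup_incl[OF \<open>T \<subseteq> fst ` K\<close> subgroup_linear_part[OF K]]
    unfolding T(3) .
  have trans: "translation_part H \<subseteq> translation_part K"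
    using group.generate_subgroup_incl[OF group_Zvec \<open>V \<subseteq> translation_part K\<close>
        translation_part_subgroup[OF K]]
    unfolding V(4) .
  have "H \<subseteq> K"
  proof
    fix h assume h: "h \<in> H"
    obtain k where k: "k \<in> K" "fst k = fst h"
      using linear h by (metis imageE imageI subsetD)
    obtain A v w where kh: "k = (A, w)" "h = (A, v)"
      using k(2) by (metis prod.collapse)
    have carr: "h \<in> carrier \<Gamma>" "k \<in> carrier \<Gamma>"
      using h k(1) subgroup.mem_carrier[OF H] subgroup.mem_carrier[OF K] by auto
    then have "A \<in> \<Lambda>"
      by (simp add: kh)
    have kh_mem: "inv\<^bsub>\<Gamma>\<^esub> k \<otimes>\<^bsub>\<Gamma>\<^esub> h \<in> H"
      using h k(1) \<open>K \<subseteq> H\<close> subgroup.m_closed[OF H] subgroup.m_inv_closed[OF H] by blast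
    obtain B where B: "B ** A = mat 1" "\<forall>v. inv\<^bsub>\<Gamma>\<^esub> (A, v) = (B, - (B *v v))"
      using \<open>A \<in> \<Lambda>\<close> by (rule inverseE) blast
    have "inv\<^bsub>\<Gamma>\<^esub> k \<otimes>\<^bsub>\<Gamma>\<^esub> h = (mat 1, - (B *v w) + B *v v)"
      by (simp add: kh B)
    then have "inv\<^bsub>\<Gamma>\<^esub> k \<otimes>\<^bsub>\<Gamma>\<^esub> h \<in> K"
      using kh_mem trans by (auto simp: translation_part_def)
    then have "k \<otimes>\<^bsub>\<Gamma>\<^esub> (inv\<^bsub>\<Gamma>\<^esub> k \<otimes>\<^bsub>\<Gamma>\<^esub> h) \<in> K"
      by (rule subgroup.m_closed[OF K k(1)])
    also have "k \<otimes>\<^bsub>\<Gamma>\<^esub> (inv\<^bsub>\<Gamma>\<^esub> k \<otimes>\<^bsub>\<Gamma>\<^esub> h) = h"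
      using carr \<Gamma>.m_assoc[of k "inv\<^bsub>\<Gamma>\<^esub> k" h] \<Gamma>.inv_closed \<Gamma>.r_inv \<Gamma>.l_one by metis
    finally show "h \<in> K" .
  qed
  with \<open>K \<subseteq> H\<close> have "generate \<Gamma> U = H"
    by (simp add: K_def)
  moreover have "finite U"
    using T(1) V(1) by (simp add: U_def)
  ultimately have "group_rank \<Gamma> H \<le> enat (card U)"
    using \<open>U \<subseteq> H\<close> by (intro group_rank_le)
  also have "card U \<le> card T + CARD('n)"
    unfolding U_def using V(2) card_image_le[OF T(1), of "\<lambda>A. (A, l A)"]
      card_image_le[OF V(1), of "Pair (mat 1 :: int ^ 'n ^ 'n)"] card_Un_le[of "(\<lambda>A. (A, l A)) ` T" "translation_set V"]
    by linarith
  finally show ?thesis by simp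
qed

text \<open>Let i be the index of the linear part and m that of the translation part. The rank is at
  most i |S| + d \<le> i (|S| + d) and the index at least i m, so i cancels in the quotient.\<close>

lemma rank_ratio_le:
  assumes S: "finite S" "S \<subseteq> \<Lambda>" "generate SLZ S = \<Lambda>"
    and H: "subgroup H \<Gamma>" and fin: "finite_index \<Gamma> H"
  obtains k where "group_rank \<Gamma> H = enat k"
    "real k / real (subgroup_index \<Gamma> H) \<le>
      (real (card S) + real CARD('n)) / real (subgroup_index Zvec (translation_part H))"
    "subgroup_index Zvec (translation_part H) \<le> subgroup_index \<Gamma> H"
proof -
  let ?i = "card (lcosets\<^bsub>linear_group\<^esub> (fst ` H))"
  let ?m = "subgroup_index Zvec (translation_part H)" and ?N = "subgroup_index \<Gamma> H"
  note fin_linear = finite_index_linear_part[OF H fin]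
  have "generate linear_group S = carrier linear_group"
    using group.generate_consistent[OF group_SLZ S(2) subgroup_\<Lambda>] S(3)
    by (simp add: linear_group_def)
  then obtain T where T: "finite T" "card T \<le> ?i * card S" "T \<subseteq> fst ` H"
    "generate linear_group T = fst ` H"
    using linear.finite_index_subgroup_generators[OF S(1) _ _ subgroup_linear_part[OF H] fin_linear]
      S(2) by auto
  have "group_rank \<Gamma> H \<le> enat (card T + CARD('n))"
    by (rule group_rank_le_extension[OF H T(1,3,4)])
  then obtain k where k: "group_rank \<Gamma> H = enat k" "k \<le> card T + CARD('n)"
    by (cases "group_rank \<Gamma> H") auto
  have "1 \<le> ?i"
    using fin_linear linear.lcosets_nonempty[OF subgroup_linear_part[OF H]]
    by (simp add: Suc_le_eq card_gt_0_iff)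
  have "0 < ?m"
    by (rule index_translation_part_pos[OF H fin])
  have N: "?i * ?m \<le> ?N"
    by (rule index_product_le[OF H fin])
  have m_le: "?m \<le> ?N"
    using mult_le_mono1[OF \<open>1 \<le> ?i\<close>, of ?m] N by linarith
  have "k \<le> ?i * card S + ?i * CARD('n)"
    using k(2) T(2) mult_le_mono1[OF \<open>1 \<le> ?i\<close>, of "CARD('n)"] by linarith
  then have "k * ?m \<le> (?i * card S + ?i * CARD('n)) * ?m"
    by (rule mult_le_mono1)
  also have "\<dots> = (card S + CARD('n)) * (?i * ?m)"
    by (simp add: algebra_simps)
  also have "\<dots> \<le> (card S + CARD('n)) * ?N"
    using N by (rule mult_le_mono2)
  finally have "real (k * ?m) \<le> real ((card S + CARD('n)) * ?N)"
    by (rule of_nat_mono)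
  then have "real k / real ?N \<le> (real (card S) + real CARD('n)) / real ?m"
    using \<open>0 < ?m\<close> m_le by (simp add: field_simps)
  with that k(1) m_le show thesis by blast
qed

end

section \<open>Soficity and the vanishing rank gradient\<close>

context integral_affine_subgroups
begin

lemma sofic: "sofic_approximation \<Gamma> \<Gamma>s"
proof (rule \<Gamma>.sofic_approximationI)
  show "countable (carrier \<Gamma>)"
    by (rule countableI_type)
  show "(\<lambda>n. real (card (fixed_cosets \<Gamma> (\<Gamma>s n) {g})) / real (card (lcosets\<^bsub>\<Gamma>\<^esub> (\<Gamma>s n)))) \<longlonglongrightarrow> 0"
    if "g \<in> carrier \<Gamma>" "g \<noteq> \<one>\<^bsub>\<Gamma>\<^esub>" for g
    using fixed_ratio_null[OF that] by (simp add: fixed_ratio_def[abs_def])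
qed (rule subgroup_\<Gamma>s finite_index_\<Gamma>s)+

text \<open>The quotient is squeezed between -1/m and C/m, where m is the index of the translation
  part and C depends only on d and a fixed finite generating set of \<Lambda>.\<close>

lemma rank_gradient:
  assumes "group_rank SLZ \<Lambda> < \<infinity>"
  shows "(\<lambda>n. (ereal_of_enat (group_rank \<Gamma> (\<Gamma>s n)) - 1) / ereal (real (subgroup_index \<Gamma> (\<Gamma>s n))))
    \<longlonglongrightarrow> 0"
proof -
  obtain S where S: "finite S" "S \<subseteq> \<Lambda>" "generate SLZ S = \<Lambda>"
    using group_rank_finiteE[OF assms] .
  define m where "m n = real (subgroup_index Zvec (translation_part (\<Gamma>s n)))" for n
  define N where "N n = real (subgroup_index \<Gamma> (\<Gamma>s n))" for n
  define C where "C = real (card S) + real CARD('n)"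
  have "\<exists>k. group_rank \<Gamma> (\<Gamma>s n) = enat k \<and> real k / N n \<le> C / m n \<and> m n \<le> N n" for n
  proof (rule rank_ratio_le[OF S subgroup_\<Gamma>s finite_index_\<Gamma>s])
    fix k
    assume "group_rank \<Gamma> (\<Gamma>s n) = enat k" "real k / real (subgroup_index \<Gamma> (\<Gamma>s n)) \<le>
        (real (card S) + real CARD('n)) / real (subgroup_index Zvec (translation_part (\<Gamma>s n)))"
      "subgroup_index Zvec (translation_part (\<Gamma>s n)) \<le> subgroup_index \<Gamma> (\<Gamma>s n)"
    then show ?thesis
      unfolding N_def m_def C_def of_nat_le_iff by (intro exI[of _ k] conjI)
  qed
  then obtain k where k: "\<And>n. group_rank \<Gamma> (\<Gamma>s n) = enat (k n)"
    and upper: "\<And>n. real (k n) / N n \<le> C / m n" and m_le: "\<And>n. m n \<le> N n"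
    by metis
  have pos: "0 < m n" for n
    using index_translation_part_pos[OF subgroup_\<Gamma>s finite_index_\<Gamma>s] by (simp add: m_def)
  have "0 < N n" for n
    using pos m_le by (rule less_le_trans)
  have "filterlim m at_top sequentially"
    unfolding m_def by (rule filterlim_compose[OF filterlim_real_sequentially index_at_top])
  then have lim: "(\<lambda>n. c / m n) \<longlonglongrightarrow> 0" for c
    by (intro real_tendsto_divide_at_top[OF tendsto_const])
  have "(\<lambda>n. (real (k n) - 1) / N n) \<longlonglongrightarrow> 0"
  proof (rule tendsto_sandwich[OF _ _ lim[of "-1"] lim[of C]])
    \<comment> \<open>The numerator is at least -1, with rank zero allowed for, and
      \<open>m n \<le> N n\<close>.\<close>
    have "- 1 / m n \<le> (real (k n) - 1) / N n" for n
    proof -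
      have "- 1 / m n \<le> - 1 / N n"
        using pos[of n] m_le[of n] by (simp add: frac_le)
      also have "\<dots> \<le> (real (k n) - 1) / N n"
        using \<open>0 < N n\<close> by (intro divide_right_mono) auto
      finally show ?thesis .
    qed
    then show "\<forall>\<^sub>F n in sequentially. - 1 / m n \<le> (real (k n) - 1) / N n"
      by simp
    have "(real (k n) - 1) / N n \<le> C / m n" for n
      using upper[of n] divide_right_mono[of "real (k n) - 1" "real (k n)" "N n"] \<open>0 < N n\<close>
      by (smt (verit))
    then show "\<forall>\<^sub>F n in sequentially. (real (k n) - 1) / N n \<le> C / m n"
      by simp
  qed
  \<comment> \<open>All ranks are finite here, so the extended real quotient is a quotient of real
    numbers.\<close>
  moreover have "(ereal_of_enat (group_rank \<Gamma> (\<Gamma>s n)) - 1) / ereal (real (subgroup_index \<Gamma> (\<Gamma>s n))) =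
      ereal ((real (k n) - 1) / N n)" for n
    using \<open>0 < N n\<close> by (simp add: k N_def one_ereal_def)
  ultimately show ?thesis
    by (simp add: zero_ereal_def)
qed

end

text \<open>If \<Lambda> is not finitely generated, then neither is \<Gamma>, nor any subgroup of
  finite index in it, and all the ranks are infinite; hence the limit is asserted for finitely
  generated \<Lambda>.\<close>

theorem theorem4p18:
  fixes \<Lambda> :: "(int ^ 'n ^ 'n) set"
    and \<Gamma> :: "((int ^ 'n ^ 'n) \<times> (int ^ 'n)) monoid"
    and \<Gamma>s :: "nat \<Rightarrow> ((int ^ 'n ^ 'n) \<times> (int ^ 'n)) set"
  defines "\<Gamma> \<equiv> semidirect_Zvec \<Lambda>"
  assumes "subgroup \<Lambda> SLZ"
    and "Z_strongly_irreducible \<Lambda>"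
    and "\<And>n. subgroup (\<Gamma>s n) \<Gamma>"
    and "\<And>n. finite_index \<Gamma> (\<Gamma>s n)"
    and "filterlim (\<lambda>n. subgroup_index Zvec (translation_part (\<Gamma>s n))) at_top sequentially"
  shows "sofic_approximation \<Gamma> \<Gamma>s \<and>
    (group_rank SLZ \<Lambda> < \<infinity> \<longrightarrow>
       (\<lambda>n. (ereal_of_enat (group_rank \<Gamma> (\<Gamma>s n)) - 1) / ereal (real (subgroup_index \<Gamma> (\<Gamma>s n))))
         \<longlonglongrightarrow> 0)"
proof -
  interpret integral_affine_subgroups \<Lambda> \<Gamma> \<Gamma>s
    unfolding \<Gamma>_def
    by (intro integral_affine_subgroups.intro integral_affine_group.intro
        integral_affine_subgroups_axioms.intro assms[unfolded \<Gamma>_def])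
  show ?thesis
    using sofic rank_gradient by blast
qed

end
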